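(* Let $(M,d)$ be a compact pointed metric space and $0<\alpha<1$. Then $(\mathrm{lip}_0(M^\alpha))^{**}$ is canonically isometric to $\mathrm{Lip}_0(M^\alpha)$ (that is, there is a surjective linear isometry $I\colon(\mathrm{lip}_0(M^\alpha))^{**}\to\mathrm{Lip}_0(M^\alpha)$ such that $I\circ\beta$ is the inclusion map $\mathrm{lip}_0(M^\alpha)\hookrightarrow\mathrm{Lip}_0(M^\alpha)$, where $\beta$ is the canonical embedding of $\mathrm{lip}_0(M^\alpha)$ into its bidual), and $\mathrm{lip}_0(M^\alpha)$ is an $M$-ideal in its bidual $\mathrm{Lip}_0(M^\alpha)$.
   Context: A pointed metric space is a metric space $(M,d)$ with a distinguished point $p\in M$. For $0<\alpha<1$, $M^\alpha$ denotes the set $M$ with the metric $d^\alpha$ and the same distinguished point. For a pointed metric space $(N,\rho)$ with distinguished point $p$, $\mathrm{Lip}_0(N)$ is the Banach space of all real-valued Lipschitz functions $F$ on $N$ with $F(p)=0$, normed by the Lipschitz constant $\|F\|_{\mathrm{Lip}}=\sup_{s\ne t}\frac{|F(s)-F(t)|}{\rho(s,t)}$. $\mathrm{lip}_0(N)$ is the closed subspace of those $f\in\mathrm{Lip}_0(N)$ with $\lim_{\rho(s,t)\to0}\frac{|f(s)-f(t)|}{\rho(s,t)}=0$ (i.e. for each $\varepsilon>0$ there is $\delta>0$ such that $|f(s)-f(t)|\le\varepsilon\,\rho(s,t)$ whenever $0<\rho(s,t)<\delta$). A closed subspace $E_0$ of a Banach space $E$ is an $M$-ideal in $E$ if there is a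 linear projection $P\colon E^*\to E^*$ with $\ker P=E_0^\perp$ (the annihilator of $E_0$ in $E^*$) such that $\|x^*\|=\|Px^*\|+\|x^*-Px^*\|$ for all $x^*\in E^*$. *)

theory Defs
  imports "HOL-Analysis.Analysis" "HOL-Library.Function_Algebras"
begin

section \<open>Pointwise vector space structure on functions\<close>

instantiation "fun" :: (type, real_vector) real_vector
begin

definition scaleR_fun :: "real \<Rightarrow> ('a \<Rightarrow> 'b) \<Rightarrow> 'a \<Rightarrow> 'b"
  where "scaleR_fun c f = (\<lambda>x. c *\<^sub>R f x)"

instance
  by standard
    (simp_all add: scaleR_fun_def plus_fun_def scaleR_add_left scaleR_add_right)

end

section \<open>Normed spaces carried by a linear subspace\<close>

text \<open>
  The spaces below depend on a metric, a base point and an exponent, so they cannot be types.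
  A normed space is therefore a set of vectors of an ambient real vector space together with a
  norm; the value of the norm off the carrier is irrelevant.
\<close>

record 'v nspace =
  nvecs :: "'v set"
  nnorm :: "'v \<Rightarrow> real"

text \<open>The distance is set to 0 off the carrier because the locale \<^locale>\<open>Metric_space\<close> asks for
  nonnegativity and symmetry on the whole type.\<close>

definition ndist :: "('v :: real_vector) nspace \<Rightarrow> 'v \<Rightarrow> 'v \<Rightarrow> real"
  where "ndist E x y = (if x \<in> nvecs E \<and> y \<in> nvecs E then nnorm E (x - y) else 0)"

definition normed_space :: "('v :: real_vector) nspace \<Rightarrow> bool"
  where "normed_space E \<longleftrightarrow> subspace (nvecs E) \<and>
    (\<forall>x\<in>nvecs E. 0 \<le> nnorm E x) \<and>
    (\<forall>x\<in>nvecs E. nnorm E x = 0 \<longleftrightarrow> x = 0) \<and>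
    (\<forall>c. \<forall>x\<in>nvecs E. nnorm E (c *\<^sub>R x) = \<bar>c\<bar> * nnorm E x) \<and>
    (\<forall>x\<in>nvecs E. \<forall>y\<in>nvecs E. nnorm E (x + y) \<le> nnorm E x + nnorm E y)"

definition banach_space :: "('v :: real_vector) nspace \<Rightarrow> bool"
  where "banach_space E \<longleftrightarrow> normed_space E \<and> Metric_space.mcomplete (nvecs E) (ndist E)"

definition closed_subspace :: "('v :: real_vector) set \<Rightarrow> 'v nspace \<Rightarrow> bool"
  where "closed_subspace S E \<longleftrightarrow> subspace S \<and> S \<subseteq> nvecs E \<and>
    closedin (Metric_space.mtopology (nvecs E) (ndist E)) S"

definition linear_map_on :: "('v :: real_vector) set \<Rightarrow> ('v \<Rightarrow> 'w :: real_vector) \<Rightarrow> bool"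
  where "linear_map_on V T \<longleftrightarrow>
    (\<forall>x\<in>V. \<forall>y\<in>V. T (x + y) = T x + T y) \<and> (\<forall>c. \<forall>x\<in>V. T (c *\<^sub>R x) = c *\<^sub>R T x)"

text \<open>A functional on \<open>E\<close> is represented by the unique function on the ambient type that vanishes
  off the carrier of \<open>E\<close>. So the dual is again a space of real functions, and \<open>dual (dual E)\<close>
  makes sense.\<close>

definition dual :: "('v :: real_vector) nspace \<Rightarrow> ('v \<Rightarrow> real) nspace"
  where "dual E = \<lparr>
    nvecs = {\<phi>. linear_map_on (nvecs E) \<phi> \<and>
                (\<exists>C. \<forall>x\<in>nvecs E. \<bar>\<phi> x\<bar> \<le> C * nnorm E x) \<and>
                (\<forall>x. x \<notin> nvecs E \<longrightarrow> \<phi> x = 0)},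
    nnorm = (\<lambda>\<phi>. Sup {\<bar>\<phi> x\<bar> | x. x \<in> nvecs E \<and> nnorm E x \<le> 1})\<rparr>"

definition canonical_embedding :: "('v :: real_vector) nspace \<Rightarrow> 'v \<Rightarrow> ('v \<Rightarrow> real) \<Rightarrow> real"
  where "canonical_embedding E x = (\<lambda>\<phi>. if \<phi> \<in> nvecs (dual E) then \<phi> x else 0)"

definition surj_linear_isometry ::
    "('v :: real_vector) nspace \<Rightarrow> ('w :: real_vector) nspace \<Rightarrow> ('v \<Rightarrow> 'w) \<Rightarrow> bool"
  where "surj_linear_isometry E F T \<longleftrightarrow>
    linear_map_on (nvecs E) T \<and> T ` nvecs E = nvecs F \<and>
    (\<forall>x\<in>nvecs E. nnorm F (T x) = nnorm E x)"

definition annihilator :: "('v :: real_vector) set \<Rightarrow> 'v nspace \<Rightarrow> ('v \<Rightarrow> real) set"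
  where "annihilator S E = {\<phi> \<in> nvecs (dual E). \<forall>x\<in>S. \<phi> x = 0}"

definition M_ideal :: "('v :: real_vector) set \<Rightarrow> 'v nspace \<Rightarrow> bool"
  where "M_ideal S E \<longleftrightarrow> banach_space E \<and> closed_subspace S E \<and>
    (\<exists>P. linear_map_on (nvecs (dual E)) P \<and>
         P ` nvecs (dual E) \<subseteq> nvecs (dual E) \<and>
         (\<forall>\<phi>\<in>nvecs (dual E). P (P \<phi>) = P \<phi>) \<and>
         {\<phi> \<in> nvecs (dual E). P \<phi> = 0} = annihilator S E \<and>
         (\<forall>\<phi>\<in>nvecs (dual E).
            nnorm (dual E) \<phi> = nnorm (dual E) (P \<phi>) + nnorm (dual E) (\<phi> - P \<phi>)))"

section \<open>Lipschitz spaces over a pointed metric space\<close>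

definition snowflake :: "real \<Rightarrow> 'a metric \<Rightarrow> 'a metric"
  where "snowflake \<alpha> m = metric (mspace m, \<lambda>s t. mdist m s t powr \<alpha>)"

lemma add_powr_le_powr_add:
  fixes a b \<alpha> :: real
  assumes "0 \<le> a" "0 \<le> b" "0 < \<alpha>" "\<alpha> \<le> 1"
  shows "(a + b) powr \<alpha> \<le> a powr \<alpha> + b powr \<alpha>"
proof (cases "a + b = 0")
  case True
  then show ?thesis by simp
next
  case False
  with assms have s: "0 < a + b" by linarith
  have *: "x / (a + b) \<le> (x / (a + b)) powr \<alpha>" if "0 \<le> x" "x \<le> a + b" for x
  proof (cases "x = 0")
    case False
    with that s have "(x / (a + b)) powr 1 \<le> (x / (a + b)) powr \<alpha>"
      using assms by (intro powr_mono') auto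
    with that s show ?thesis by simp
  qed simp
  have "1 = a / (a + b) + b / (a + b)"
    using s by (simp add: add_divide_distrib[symmetric])
  also have "\<dots> \<le> (a / (a + b)) powr \<alpha> + (b / (a + b)) powr \<alpha>"
    using assms by (intro add_mono *) auto
  also have "\<dots> = (a powr \<alpha> + b powr \<alpha>) / (a + b) powr \<alpha>"
    using assms s by (simp add: powr_divide add_divide_distrib)
  finally show ?thesis
    using s by (simp add: le_divide_eq)
qed

lemma Metric_space_snowflake:
  assumes "0 < \<alpha>" "\<alpha> \<le> 1"
  shows "Metric_space (mspace m) (\<lambda>s t. mdist m s t powr \<alpha>)"
proof
  fix x y z assume xyz: "x \<in> mspace m" "y \<in> mspace m" "z \<in> mspace m"
  have "mdist m x z powr \<alpha> \<le> (mdist m x y + mdist m y z) powr \<alpha>"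
    using assms xyz by (intro powr_mono2) (auto intro: mdist_triangle)
  also have "\<dots> \<le> mdist m x y powr \<alpha> + mdist m y z powr \<alpha>"
    using assms by (intro add_powr_le_powr_add) auto
  finally show "mdist m x z powr \<alpha> \<le> mdist m x y powr \<alpha> + mdist m y z powr \<alpha>" .
qed (auto simp: mdist_commute)

lemma mspace_snowflake [simp]:
  "0 < \<alpha> \<Longrightarrow> \<alpha> \<le> 1 \<Longrightarrow> mspace (snowflake \<alpha> m) = mspace m"
  by (simp add: snowflake_def Metric_space.mspace_metric Metric_space_snowflake)

lemma mdist_snowflake [simp]:
  "0 < \<alpha> \<Longrightarrow> \<alpha> \<le> 1 \<Longrightarrow> mdist (snowflake \<alpha> m) s t = mdist m s t powr \<alpha>"
  by (simp add: snowflake_def Metric_space.mdist_metric Metric_space_snowflake)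

text \<open>The inserted 0 only matters for a one-point space, where the supremum would be over the
  empty set.\<close>

definition lip_norm :: "'a metric \<Rightarrow> ('a \<Rightarrow> real) \<Rightarrow> real"
  where "lip_norm m f =
    Sup (insert 0 {\<bar>f s - f t\<bar> / mdist m s t | s t. s \<in> mspace m \<and> t \<in> mspace m \<and> s \<noteq> t})"

text \<open>As for functionals, a function on the metric space is represented by the function on the type
  that vanishes off \<^term>\<open>mspace m\<close>.\<close>

definition Lip0 :: "'a metric \<Rightarrow> 'a \<Rightarrow> ('a \<Rightarrow> real) nspace"
  where "Lip0 m p = \<lparr>
    nvecs = {f. Lipschitz_continuous_map m euclidean_metric f \<and> f p = 0 \<and>
                (\<forall>s. s \<notin> mspace m \<longrightarrow> f s = 0)},
    nnorm = lip_norm m\<rparr>"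

definition lip0 :: "'a metric \<Rightarrow> 'a \<Rightarrow> ('a \<Rightarrow> real) nspace"
  where "lip0 m p = \<lparr>
    nvecs = {f \<in> nvecs (Lip0 m p). \<forall>\<epsilon>>0. \<exists>\<delta>>0. \<forall>s\<in>mspace m. \<forall>t\<in>mspace m.
               0 < mdist m s t \<and> mdist m s t < \<delta> \<longrightarrow> \<bar>f s - f t\<bar> \<le> \<epsilon> * mdist m s t},
    nnorm = lip_norm m\<rparr>"

end

theory Submission
  imports Defs
begin

text \<open>
  The proof rests on two facts about the spaces over a snowflaked metric. First, if \<open>f\<close> lies in lip0
  and \<open>g\<close> in Lip0 is uniformly small compared with the scale of \<open>f\<close>, then the norm of \<open>f + g\<close> is almost
  the maximum of the two norms (\<open>norm_little_add_small\<close>). Second, every \<open>F\<close> in Lip0 is a uniform limit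
  of functions in lip0 of norm at most that of \<open>F\<close> (\<open>snowflake_approximable\<close>): the infimal convolution
  of \<open>F\<close> with a truncation of the snowflaked metric that is linear at small distances.

  The first fact allows a gliding hump: a functional on lip0 is small on bounded functions
  that are uniformly small (\<open>little_functional_small\<close>). With the second fact every functional \<open>\<phi>\<close> on lip0
  extends to Lip0 without increase of norm, by passing to limits along bounded uniformly convergent
  sequences (\<open>functional_tendsto_lip_extension\<close>).

  For the bidual, an element \<open>\<Phi>\<close> is sent to the function \<open>s \<mapsto> \<Phi> (eval_at s)\<close>. A function \<open>F\<close> in Lip0 is
  the image of the functional that takes \<open>\<phi>\<close> to the value of its extension at \<open>F\<close>. Finite combinations of
  evaluations are dense in the dual of lip0: on a totally bounded space the functions
  vanishing on a fine finite net are uniformly small, so every functional is small on them, and a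
  finite-dimensional Hahn--Banach argument applies (\<open>evaluations_dense\<close>). Density makes the map
  isometric (\<open>bidual_bound\<close>).

  For the M-ideal property, \<open>P \<psi>\<close> is the extension of the restriction of \<open>\<psi>\<close> to lip0. To see that the
  norms of \<open>P \<psi>\<close> and \<open>\<psi> - P \<psi>\<close> add up to that of \<open>\<psi>\<close>, one needs a single function of norm about 1 on which
  both are almost attained. It is \<open>f + (G - g)\<close> with \<open>f\<close> and \<open>g\<close> in lip0, where \<open>g\<close> is an average of
  approximants of \<open>G\<close> of many different scales; the averaging keeps the norm of \<open>G - g\<close> near 1
  (\<open>almost_norm_preserving_approximation\<close>).
\<close>

section \<open>Duals of normed spaces carried by subspaces\<close>

lemma scaleR_fun_apply [simp]: "(c *\<^sub>R f) x = c *\<^sub>R f x"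
  by (simp add: scaleR_fun_def)

lemma normed_space_subspace: "normed_space E \<Longrightarrow> subspace (nvecs E)"
  by (simp add: normed_space_def)

lemma nnorm_nonneg: "normed_space E \<Longrightarrow> x \<in> nvecs E \<Longrightarrow> 0 \<le> nnorm E x"
  by (simp add: normed_space_def)

lemma nnorm_eq_0_iff: "normed_space E \<Longrightarrow> x \<in> nvecs E \<Longrightarrow> nnorm E x = 0 \<longleftrightarrow> x = 0"
  by (simp add: normed_space_def)

lemma nnorm_scale: "normed_space E \<Longrightarrow> x \<in> nvecs E \<Longrightarrow> nnorm E (c *\<^sub>R x) = \<bar>c\<bar> * nnorm E x"
  by (simp add: normed_space_def)

lemma nnorm_triangle:
  "normed_space E \<Longrightarrow> x \<in> nvecs E \<Longrightarrow> y \<in> nvecs E \<Longrightarrow> nnorm E (x + y) \<le> nnorm E x + nnorm E y"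
  by (simp add: normed_space_def)

lemma nnorm_zero: "normed_space E \<Longrightarrow> nnorm E 0 = 0"
  using nnorm_eq_0_iff normed_space_subspace subspace_0 by blast

lemma nnorm_minus:
  assumes "normed_space E" "x \<in> nvecs E" shows "nnorm E (- x) = nnorm E x"
  using nnorm_scale[OF assms, of "-1"] by simp

lemma Metric_space_ndist:
  assumes E: "normed_space E"
  shows "Metric_space (nvecs E) (ndist E)"
proof
  have diff: "x - y \<in> nvecs E" if "x \<in> nvecs E" "y \<in> nvecs E" for x y
    using that E normed_space_subspace subspace_diff by blast
  show "0 \<le> ndist E x y" for x y
    by (simp add: ndist_def diff nnorm_nonneg[OF E])
  show "ndist E x y = ndist E y x" for x y
    using nnorm_minus[OF E diff, of x y] by (simp add: ndist_def)
  fix x y z assume xyz: "x \<in> nvecs E" "y \<in> nvecs E"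
  then show "(ndist E x y = 0) = (x = y)"
    by (simp add: ndist_def diff nnorm_eq_0_iff[OF E])
  assume "z \<in> nvecs E"
  then show "ndist E x z \<le> ndist E x y + ndist E y z"
    using nnorm_triangle[OF E diff diff, of x y y z] xyz by (simp add: ndist_def)
qed

lemma linear_map_on_diff:
  assumes "linear_map_on V T" "subspace V" "x \<in> V" "y \<in> V"
  shows "T (x - y) = T x - T y"
proof -
  have "T (x + (-1) *\<^sub>R y) = T x + (-1) *\<^sub>R T y"
    using assms subspace_scale[OF assms(2,4), of "-1"] unfolding linear_map_on_def by metis
  then show ?thesis by simp
qed

lemma linear_map_on_zero:
  assumes "linear_map_on V T" "subspace V"
  shows "T 0 = 0"
  using linear_map_on_diff[OF assms, of 0 0] subspace_0[OF assms(2)] by simp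

lemma linear_map_on_sum:
  assumes T: "linear_map_on V T" "subspace V" and x: "\<And>i. i \<in> A \<Longrightarrow> x i \<in> V"
  shows "T (\<Sum>i\<in>A. c i *\<^sub>R x i) = (\<Sum>i\<in>A. c i *\<^sub>R T (x i))"
  using x
proof (induction A rule: infinite_finite_induct)
  case (insert i A)
  then have "(\<Sum>i\<in>A. c i *\<^sub>R x i) \<in> V" "c i *\<^sub>R x i \<in> V"
    using T(2) by (auto intro: subspace_sum subspace_scale)
  with insert T(1) show ?case
    by (simp add: linear_map_on_def)
qed (use linear_map_on_zero[OF T] in auto)

lemma dual_linear: "\<phi> \<in> nvecs (dual E) \<Longrightarrow> linear_map_on (nvecs E) \<phi>"
  by (simp add: dual_def)

lemma dual_add:
  "\<phi> \<in> nvecs (dual E) \<Longrightarrow> x \<in> nvecs E \<Longrightarrow> y \<in> nvecs E \<Longrightarrow> \<phi> (x + y) = \<phi> x + \<phi> y"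
  by (simp add: dual_def linear_map_on_def)

lemma dual_scale: "\<phi> \<in> nvecs (dual E) \<Longrightarrow> x \<in> nvecs E \<Longrightarrow> \<phi> (c *\<^sub>R x) = c * \<phi> x"
  by (simp add: dual_def linear_map_on_def)

lemma dual_diff:
  assumes "normed_space E" "\<phi> \<in> nvecs (dual E)" "x \<in> nvecs E" "y \<in> nvecs E"
  shows "\<phi> (x - y) = \<phi> x - \<phi> y"
  using linear_map_on_diff assms dual_linear normed_space_subspace by blast

lemma dual_zero: "normed_space E \<Longrightarrow> \<phi> \<in> nvecs (dual E) \<Longrightarrow> \<phi> 0 = 0"
  using linear_map_on_zero dual_linear normed_space_subspace by blast

lemma dual_minus:
  "normed_space E \<Longrightarrow> \<phi> \<in> nvecs (dual E) \<Longrightarrow> x \<in> nvecs E \<Longrightarrow> \<phi> (- x) = - \<phi> x"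
  using dual_scale[of \<phi> E x "-1"] by simp

lemma dual_outside: "\<phi> \<in> nvecs (dual E) \<Longrightarrow> x \<notin> nvecs E \<Longrightarrow> \<phi> x = 0"
  by (simp add: dual_def)

lemma dual_eqI:
  assumes "\<phi> \<in> nvecs (dual E)" "\<psi> \<in> nvecs (dual E)" "\<And>x. x \<in> nvecs E \<Longrightarrow> \<phi> x = \<psi> x"
  shows "\<phi> = \<psi>"
proof
  show "\<phi> x = \<psi> x" for x
    by (cases "x \<in> nvecs E") (simp_all add: assms dual_outside[OF assms(1)] dual_outside[OF assms(2)])
qed

lemma dualI:
  assumes "linear_map_on (nvecs E) \<phi>" "\<And>x. x \<in> nvecs E \<Longrightarrow> \<bar>\<phi> x\<bar> \<le> C * nnorm E x"
    and "\<And>x. x \<notin> nvecs E \<Longrightarrow> \<phi> x = 0"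
  shows "\<phi> \<in> nvecs (dual E)"
  using assms by (auto simp: dual_def)

lemma dual_norm_upper:
  assumes E: "normed_space E" and \<phi>: "\<phi> \<in> nvecs (dual E)"
    and x: "x \<in> nvecs E" "nnorm E x \<le> 1"
  shows "\<bar>\<phi> x\<bar> \<le> nnorm (dual E) \<phi>"
proof -
  obtain C where C: "\<And>x. x \<in> nvecs E \<Longrightarrow> \<bar>\<phi> x\<bar> \<le> C * nnorm E x"
    using \<phi> by (auto simp: dual_def)
  have "\<bar>\<phi> y\<bar> \<le> \<bar>C\<bar>" if y: "y \<in> nvecs E" "nnorm E y \<le> 1" for y
  proof -
    have "\<bar>\<phi> y\<bar> \<le> C * nnorm E y" using C y by blast
    also have "\<dots> \<le> \<bar>C\<bar> * 1"
      using y nnorm_nonneg[OF E y(1)] by (intro mult_mono) auto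
    finally show ?thesis by simp
  qed
  then have "bdd_above {\<bar>\<phi> x\<bar> |x. x \<in> nvecs E \<and> nnorm E x \<le> 1}"
    by (auto intro!: bdd_aboveI[of _ "\<bar>C\<bar>"])
  then show ?thesis
    using x by (auto simp: dual_def intro!: cSup_upper)
qed

lemma dual_norm_bound:
  assumes E: "normed_space E" and \<phi>: "\<phi> \<in> nvecs (dual E)" and x: "x \<in> nvecs E"
  shows "\<bar>\<phi> x\<bar> \<le> nnorm (dual E) \<phi> * nnorm E x"
proof (cases "x = 0")
  case True
  then show ?thesis by (simp add: dual_zero[OF E \<phi>] nnorm_zero[OF E])
next
  case False
  then have n: "0 < nnorm E x"
    using nnorm_nonneg[OF E x] nnorm_eq_0_iff[OF E x] by linarith
  let ?u = "(1 / nnorm E x) *\<^sub>R x"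
  have u: "?u \<in> nvecs E" "nnorm E ?u \<le> 1"
    using x n by (simp_all add: normed_space_subspace[OF E] subspace_scale nnorm_scale[OF E])
  then have "\<bar>\<phi> ?u\<bar> \<le> nnorm (dual E) \<phi>"
    by (rule dual_norm_upper[OF E \<phi>])
  moreover have "\<bar>\<phi> ?u\<bar> = \<bar>\<phi> x\<bar> / nnorm E x"
    using n by (simp add: dual_scale[OF \<phi> x])
  ultimately show ?thesis
    using n by (simp add: divide_le_eq)
qed

lemma dual_norm_leI:
  assumes E: "normed_space E"
    and le: "\<And>x. x \<in> nvecs E \<Longrightarrow> nnorm E x \<le> 1 \<Longrightarrow> \<bar>\<phi> x\<bar> \<le> C"
  shows "nnorm (dual E) \<phi> \<le> C"
proof -
  have "\<bar>\<phi> 0\<bar> \<in> {\<bar>\<phi> x\<bar> |x. x \<in> nvecs E \<and> nnorm E x \<le> 1}"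
    using normed_space_subspace[OF E, THEN subspace_0] nnorm_zero[OF E]
    by (intro CollectI exI[of _ 0]) simp
  then have "Sup {\<bar>\<phi> x\<bar> |x. x \<in> nvecs E \<and> nnorm E x \<le> 1} \<le> C"
    using le by (intro cSup_least) blast+
  then show ?thesis by (simp add: dual_def)
qed

lemma dual_norm_attained_approx:
  assumes E: "normed_space E" and \<phi>: "\<phi> \<in> nvecs (dual E)" and e: "0 < e"
  obtains x where "x \<in> nvecs E" "nnorm E x \<le> 1" "nnorm (dual E) \<phi> - e < \<phi> x"
proof -
  have "\<exists>x. x \<in> nvecs E \<and> nnorm E x \<le> 1 \<and> nnorm (dual E) \<phi> - e < \<bar>\<phi> x\<bar>"
  proof (rule ccontr)
    assume "\<not> ?thesis"
    then have "nnorm (dual E) \<phi> \<le> nnorm (dual E) \<phi> - e"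
      by (intro dual_norm_leI[OF E]) (auto simp: not_less)
    with e show False by simp
  qed
  then obtain x where x: "x \<in> nvecs E" "nnorm E x \<le> 1" "nnorm (dual E) \<phi> - e < \<bar>\<phi> x\<bar>"
    by blast
  show thesis
  proof (cases "0 \<le> \<phi> x")
    case True
    with x that show ?thesis by auto
  next
    case False
    with x that[of "- x"] show ?thesis
      by (simp add: dual_minus[OF E \<phi>] nnorm_minus[OF E] normed_space_subspace[OF E] subspace_neg)
  qed
qed

lemma normed_space_dual:
  assumes E: "normed_space E"
  shows "normed_space (dual E)"
proof -
  note bound = dual_norm_bound[OF E]
  have nonneg: "0 \<le> nnorm (dual E) \<phi>" if \<phi>: "\<phi> \<in> nvecs (dual E)" for \<phi>
    using dual_norm_upper[OF E \<phi>, of 0] normed_space_subspace[OF E, THEN subspace_0] nnorm_zero[OF E]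
    by simp
  have add: "\<phi> + \<psi> \<in> nvecs (dual E)" "nnorm (dual E) (\<phi> + \<psi>) \<le> nnorm (dual E) \<phi> + nnorm (dual E) \<psi>"
    if \<phi>: "\<phi> \<in> nvecs (dual E)" and \<psi>: "\<psi> \<in> nvecs (dual E)" for \<phi> \<psi>
  proof -
    have b: "\<bar>(\<phi> + \<psi>) x\<bar> \<le> (nnorm (dual E) \<phi> + nnorm (dual E) \<psi>) * nnorm E x" if "x \<in> nvecs E" for x
      using bound[OF \<phi> that] bound[OF \<psi> that] by (simp add: distrib_right)
    show "\<phi> + \<psi> \<in> nvecs (dual E)"
      by (rule dualI[OF _ b])
        (use \<phi> \<psi> in \<open>auto simp: linear_map_on_def dual_add dual_scale dual_outside algebra_simps\<close>)
    show "nnorm (dual E) (\<phi> + \<psi>) \<le> nnorm (dual E) \<phi> + nnorm (dual E) \<psi>"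
    proof (rule dual_norm_leI[OF E])
      fix x assume x: "x \<in> nvecs E" "nnorm E x \<le> 1"
      note b[OF x(1)]
      also have "(nnorm (dual E) \<phi> + nnorm (dual E) \<psi>) * nnorm E x
          \<le> (nnorm (dual E) \<phi> + nnorm (dual E) \<psi>) * 1"
        using x nonneg[OF \<phi>] nonneg[OF \<psi>] by (intro mult_left_mono) auto
      finally show "\<bar>(\<phi> + \<psi>) x\<bar> \<le> nnorm (dual E) \<phi> + nnorm (dual E) \<psi>" by simp
    qed
  qed
  have scale: "c *\<^sub>R \<phi> \<in> nvecs (dual E)" "nnorm (dual E) (c *\<^sub>R \<phi>) \<le> \<bar>c\<bar> * nnorm (dual E) \<phi>"
    if \<phi>: "\<phi> \<in> nvecs (dual E)" for \<phi> c
  proof -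
    have b: "\<bar>(c *\<^sub>R \<phi>) x\<bar> \<le> (\<bar>c\<bar> * nnorm (dual E) \<phi>) * nnorm E x" if "x \<in> nvecs E" for x
      using mult_left_mono[OF bound[OF \<phi> that], of "\<bar>c\<bar>"] by (simp add: abs_mult mult.assoc)
    show "c *\<^sub>R \<phi> \<in> nvecs (dual E)"
      by (rule dualI[OF _ b])
        (use \<phi> in \<open>auto simp: linear_map_on_def dual_add dual_scale dual_outside algebra_simps\<close>)
    show "nnorm (dual E) (c *\<^sub>R \<phi>) \<le> \<bar>c\<bar> * nnorm (dual E) \<phi>"
    proof (rule dual_norm_leI[OF E])
      fix x assume x: "x \<in> nvecs E" "nnorm E x \<le> 1"
      note b[OF x(1)]
      also have "(\<bar>c\<bar> * nnorm (dual E) \<phi>) * nnorm E x \<le> (\<bar>c\<bar> * nnorm (dual E) \<phi>) * 1"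
        using x nonneg[OF \<phi>] by (intro mult_left_mono) auto
      finally show "\<bar>(c *\<^sub>R \<phi>) x\<bar> \<le> \<bar>c\<bar> * nnorm (dual E) \<phi>" by simp
    qed
  qed
  have zero: "0 \<in> nvecs (dual E)"
    by (rule dualI[of _ _ 0]) (auto simp: linear_map_on_def)
  have scale_eq: "nnorm (dual E) (c *\<^sub>R \<phi>) = \<bar>c\<bar> * nnorm (dual E) \<phi>" if \<phi>: "\<phi> \<in> nvecs (dual E)" for \<phi> c
  proof (cases "c = 0")
    case True
    with nonneg[OF scale(1)[OF \<phi>, of 0]] scale(2)[OF \<phi>, of 0] show ?thesis by simp
  next
    case False
    have "nnorm (dual E) \<phi> \<le> \<bar>1 / c\<bar> * nnorm (dual E) (c *\<^sub>R \<phi>)"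
      using scale(2)[OF scale(1)[OF \<phi>], of "1 / c" c] False by simp
    then have "\<bar>c\<bar> * nnorm (dual E) \<phi> \<le> nnorm (dual E) (c *\<^sub>R \<phi>)"
      using False by (simp add: pos_le_divide_eq mult.commute)
    with scale(2)[OF \<phi>, of c] show ?thesis by simp
  qed
  have "\<phi> = 0" if \<phi>: "\<phi> \<in> nvecs (dual E)" and "nnorm (dual E) \<phi> = 0" for \<phi>
    using bound[OF \<phi>] that by (intro dual_eqI[OF \<phi> zero]) auto
  moreover have "nnorm (dual E) 0 = 0"
    using scale_eq[OF zero, of 0] by simp
  ultimately have "\<forall>\<phi>\<in>nvecs (dual E). nnorm (dual E) \<phi> = 0 \<longleftrightarrow> \<phi> = 0"
    by metis
  moreover have "subspace (nvecs (dual E))"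
    unfolding subspace_def using zero add(1) scale(1) by simp
  ultimately show ?thesis
    unfolding normed_space_def using nonneg add(2) scale_eq by simp
qed

lemma dual_norm_leI_bound:
  assumes E: "normed_space E" and C: "0 \<le> C"
    and le: "\<And>x. x \<in> nvecs E \<Longrightarrow> \<bar>\<phi> x\<bar> \<le> C * nnorm E x"
  shows "nnorm (dual E) \<phi> \<le> C"
proof (rule dual_norm_leI[OF E])
  fix x assume x: "x \<in> nvecs E" "nnorm E x \<le> 1"
  show "\<bar>\<phi> x\<bar> \<le> C"
    using le[OF x(1)] mult_left_mono[OF x(2) C] by simp
qed

text \<open>
  This is the one-dimensional step of the Hahn--Banach theorem: the numbers \<open>a\<close> for which
  \<open>\<phi> - a \<delta>\<close> has norm at most \<open>e\<close> form the gap between a supremum and an infimum over the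
  hyperplane \<open>\<delta> = 1\<close>, and the two cannot cross because a difference of two points of the
  hyperplane lies in the kernel of \<open>\<delta>\<close>, where \<open>\<phi>\<close> is small.
\<close>

lemma small_on_kernel_imp_near_multiple:
  fixes \<phi> \<delta> :: "'v :: real_vector \<Rightarrow> real"
  assumes E: "normed_space E" and V: "subspace V" "V \<subseteq> nvecs E"
    and \<phi>: "linear_map_on V \<phi>" and \<delta>: "linear_map_on V \<delta>" and e: "0 \<le> e"
    and small: "\<And>x. x \<in> V \<Longrightarrow> \<delta> x = 0 \<Longrightarrow> \<bar>\<phi> x\<bar> \<le> e * nnorm E x"
  obtains a where "\<And>x. x \<in> V \<Longrightarrow> \<bar>\<phi> x - a * \<delta> x\<bar> \<le> e * nnorm E x"
proof (cases "\<exists>x\<in>V. \<delta> x \<noteq> 0")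
  case False
  with small that[of 0] show ?thesis by simp
next
  case True
  then obtain x0 where x0: "x0 \<in> V" "\<delta> x0 \<noteq> 0" by blast
  \<comment> \<open>By homogeneity it is enough to find \<open>a\<close> on the affine hyperplane.\<close>
  define S where "S = {x \<in> V. \<delta> x = 1}"
  have "(1 / \<delta> x0) *\<^sub>R x0 \<in> S"
    using x0 \<delta> V subspace_scale[OF V(1)] by (simp add: S_def linear_map_on_def)
  then have ne: "S \<noteq> {}" by blast
  have gap: "\<phi> x - e * nnorm E x \<le> \<phi> y + e * nnorm E y" if "x \<in> S" "y \<in> S" for x y
  proof -
    have xy: "x \<in> V" "y \<in> V" "\<delta> (x - y) = 0"
      using that linear_map_on_diff[OF \<delta> V(1)] by (auto simp: S_def)
    have "\<bar>\<phi> x - \<phi> y\<bar> \<le> e * nnorm E (x - y)"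
      using small[of "x - y"] xy linear_map_on_diff[OF \<phi> V(1)] subspace_diff[OF V(1)] by simp
    also have "\<dots> \<le> e * (nnorm E x + nnorm E y)"
      using nnorm_triangle[OF E, of x "- y"] nnorm_minus[OF E, of y] subspace_neg[OF V(1) xy(2)]
        subsetD[OF V(2)] xy e
      by (intro mult_left_mono) simp_all
    finally show ?thesis by (simp add: distrib_left)
  qed
  define a where "a = (SUP x\<in>S. \<phi> x - e * nnorm E x)"
  have lower: "\<phi> x - e * nnorm E x \<le> a" if "x \<in> S" for x
    unfolding a_def using that gap[OF _ that] by (intro cSUP_upper bdd_aboveI2) auto
  have upper: "a \<le> \<phi> x + e * nnorm E x" if "x \<in> S" for x
    unfolding a_def using ne gap[OF _ that] by (intro cSUP_least)
  show thesis
  proof (rule that[of a])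
    fix x assume x: "x \<in> V"
    show "\<bar>\<phi> x - a * \<delta> x\<bar> \<le> e * nnorm E x"
    proof (cases "\<delta> x = 0")
      case True
      with small x show ?thesis by simp
    next
      case False
      let ?y = "(1 / \<delta> x) *\<^sub>R x"
      have y: "?y \<in> S"
        using x False \<delta> subspace_scale[OF V(1)] by (simp add: S_def linear_map_on_def)
      have "\<bar>\<phi> ?y - a\<bar> \<le> e * nnorm E ?y"
        using lower[OF y] upper[OF y] by linarith
      moreover have "\<phi> ?y = \<phi> x / \<delta> x" "nnorm E ?y = nnorm E x / \<bar>\<delta> x\<bar>"
        using x V(2) \<phi> by (auto simp: linear_map_on_def nnorm_scale[OF E])
      ultimately have "\<bar>\<delta> x\<bar> * \<bar>\<phi> x / \<delta> x - a\<bar> \<le> \<bar>\<delta> x\<bar> * (e * (nnorm E x / \<bar>\<delta> x\<bar>))"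
        by (intro mult_left_mono) auto
      moreover have "\<bar>\<delta> x\<bar> * \<bar>\<phi> x / \<delta> x - a\<bar> = \<bar>\<phi> x - a * \<delta> x\<bar>"
        unfolding abs_mult[symmetric] using False by (simp add: right_diff_distrib mult.commute)
      ultimately show ?thesis
        using False by simp
    qed
  qed
qed

text \<open>
  Induction on the number of functionals: inside the kernel of one of them the others suffice, and
  that one is then corrected for by the previous lemma.
\<close>

lemma small_on_joint_kernel_imp_near_span:
  fixes \<phi> :: "'v :: real_vector \<Rightarrow> real" and \<delta> :: "'i \<Rightarrow> 'v \<Rightarrow> real"
  assumes E: "normed_space E" and e: "0 \<le> e" and A: "finite A"
    and V: "subspace V" "V \<subseteq> nvecs E"
    and \<phi>: "linear_map_on V \<phi>" and \<delta>: "\<And>i. i \<in> A \<Longrightarrow> linear_map_on V (\<delta> i)"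
    and small: "\<And>x. x \<in> V \<Longrightarrow> (\<And>i. i \<in> A \<Longrightarrow> \<delta> i x = 0) \<Longrightarrow> \<bar>\<phi> x\<bar> \<le> e * nnorm E x"
  shows "\<exists>a. \<forall>x\<in>V. \<bar>\<phi> x - (\<Sum>i\<in>A. a i * \<delta> i x)\<bar> \<le> e * nnorm E x"
  using A V \<phi> \<delta> small
proof (induction A arbitrary: V rule: finite_induct)
  case empty
  then show ?case by simp
next
  case (insert j A)
  let ?K = "{x \<in> V. \<delta> j x = 0}"
  have \<delta>j: "linear_map_on V (\<delta> j)" using insert.prems by blast
  have sub: "subspace ?K"
    using \<open>subspace V\<close> \<delta>j linear_map_on_zero[OF \<delta>j \<open>subspace V\<close>]
    by (auto simp: subspace_def linear_map_on_def)
  have lin: "linear_map_on ?K f" if "linear_map_on V f" for f :: "'v \<Rightarrow> real"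
    using that by (auto simp: linear_map_on_def)
  have "\<exists>a. \<forall>x\<in>?K. \<bar>\<phi> x - (\<Sum>i\<in>A. a i * \<delta> i x)\<bar> \<le> e * nnorm E x"
  proof (rule insert.IH[OF sub])
    show "\<bar>\<phi> x\<bar> \<le> e * nnorm E x" if "x \<in> ?K" "\<And>i. i \<in> A \<Longrightarrow> \<delta> i x = 0" for x
      by (rule insert.prems(5)) (use that in auto)
  qed (use insert.prems lin in auto)
  then obtain a where a: "\<And>x. x \<in> ?K \<Longrightarrow> \<bar>\<phi> x - (\<Sum>i\<in>A. a i * \<delta> i x)\<bar> \<le> e * nnorm E x"
    by blast
  have "linear_map_on V (\<lambda>x. \<phi> x - (\<Sum>i\<in>A. a i * \<delta> i x))"
    unfolding linear_map_on_def
  proof (intro conjI ballI allI)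
    fix x y c assume "x \<in> V" "y \<in> V"
    then have "(\<Sum>i\<in>A. a i * \<delta> i (x + y)) = (\<Sum>i\<in>A. a i * \<delta> i x) + (\<Sum>i\<in>A. a i * \<delta> i y)"
      using insert.prems(4)
      by (subst sum.distrib[symmetric]) (auto simp: linear_map_on_def distrib_left intro!: sum.cong)
    then show "\<phi> (x + y) - (\<Sum>i\<in>A. a i * \<delta> i (x + y))
        = (\<phi> x - (\<Sum>i\<in>A. a i * \<delta> i x)) + (\<phi> y - (\<Sum>i\<in>A. a i * \<delta> i y))"
      using insert.prems(3) \<open>x \<in> V\<close> \<open>y \<in> V\<close> by (simp add: linear_map_on_def)
  next
    fix x c assume "x \<in> V"
    then have "(\<Sum>i\<in>A. a i * \<delta> i (c *\<^sub>R x)) = c * (\<Sum>i\<in>A. a i * \<delta> i x)"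
      using insert.prems(4)
      by (subst sum_distrib_left) (auto simp: linear_map_on_def intro!: sum.cong)
    then show "\<phi> (c *\<^sub>R x) - (\<Sum>i\<in>A. a i * \<delta> i (c *\<^sub>R x))
        = c *\<^sub>R (\<phi> x - (\<Sum>i\<in>A. a i * \<delta> i x))"
      using insert.prems(3) \<open>x \<in> V\<close> by (simp add: linear_map_on_def right_diff_distrib)
  qed
  then obtain b where
    b: "\<And>x. x \<in> V \<Longrightarrow> \<bar>(\<phi> x - (\<Sum>i\<in>A. a i * \<delta> i x)) - b * \<delta> j x\<bar> \<le> e * nnorm E x"
    using small_on_kernel_imp_near_multiple[OF E \<open>subspace V\<close> \<open>V \<subseteq> nvecs E\<close> _ \<delta>j e] a by blast
  have "(\<Sum>i\<in>insert j A. (a(j := b)) i * \<delta> i x) = b * \<delta> j x + (\<Sum>i\<in>A. a i * \<delta> i x)" for x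
    using insert.hyps by (auto intro!: sum.cong)
  with b show ?case
    by (intro exI[of _ "a(j := b)"]) (auto simp: algebra_simps)
qed

lemma mdist_pos:
  "s \<in> mspace m \<Longrightarrow> t \<in> mspace m \<Longrightarrow> s \<noteq> t \<Longrightarrow> 0 < mdist m s t"
  by (metis mdist_nonneg mdist_zero less_eq_real_def)

lemma mdist_self [simp]: "s \<in> mspace m \<Longrightarrow> mdist m s s = 0"
  by simp

section \<open>The Banach space Lip0 and its closed subspace lip0\<close>

lemma lip_norm_leI:
  assumes "0 \<le> C"
    and "\<And>s t. s \<in> mspace m \<Longrightarrow> t \<in> mspace m \<Longrightarrow> s \<noteq> t \<Longrightarrow> \<bar>f s - f t\<bar> \<le> C * mdist m s t"
  shows "lip_norm m f \<le> C"
  unfolding lip_norm_def using assms by (intro cSup_least) (auto simp: pos_divide_le_eq mdist_pos)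

lemma Lip0I:
  assumes "\<And>s t. s \<in> mspace m \<Longrightarrow> t \<in> mspace m \<Longrightarrow> \<bar>f s - f t\<bar> \<le> C * mdist m s t"
    and "f p = 0" "\<And>s. s \<notin> mspace m \<Longrightarrow> f s = 0"
  shows "f \<in> nvecs (Lip0 m p)"
  using assms by (auto simp: Lip0_def Lipschitz_continuous_map_def dist_real_def)

text \<open>
  Inside this locale, \<open>big\<close> and \<open>little\<close> are the sets of functions of the spaces Lip0 and lip0, and
  \<open>N\<close> is the Lipschitz norm that both spaces carry.
\<close>

locale pointed_metric =
  fixes m :: "'a metric" and p :: 'a
  assumes base_point: "p \<in> mspace m"
begin

abbreviation big :: "('a \<Rightarrow> real) set" where "big \<equiv> nvecs (Lip0 m p)"
abbreviation little :: "('a \<Rightarrow> real) set" where "little \<equiv> nvecs (lip0 m p)"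
abbreviation N :: "('a \<Rightarrow> real) \<Rightarrow> real" where "N \<equiv> lip_norm m"

lemma nnorm_Lip0 [simp]: "nnorm (Lip0 m p) = N" and nnorm_lip0 [simp]: "nnorm (lip0 m p) = N"
  by (simp_all add: Lip0_def lip0_def)

lemma little_imp_big: "f \<in> little \<Longrightarrow> f \<in> big"
  by (simp add: lip0_def)

lemma big_base_point: "f \<in> big \<Longrightarrow> f p = 0"
  and big_outside: "f \<in> big \<Longrightarrow> s \<notin> mspace m \<Longrightarrow> f s = 0"
  by (simp_all add: Lip0_def)

lemma lip_bound:
  assumes f: "f \<in> big" and s: "s \<in> mspace m" "t \<in> mspace m"
  shows "\<bar>f s - f t\<bar> \<le> N f * mdist m s t"
proof (cases "s = t")
  case False
  then have pos: "0 < mdist m s t" using s by (simp add: mdist_pos)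
  obtain C where C: "\<And>s t. s \<in> mspace m \<Longrightarrow> t \<in> mspace m \<Longrightarrow> \<bar>f s - f t\<bar> \<le> C * mdist m s t"
    using f by (auto simp: Lip0_def Lipschitz_continuous_map_def dist_real_def)
  have "bdd_above (insert 0 {\<bar>f s - f t\<bar> / mdist m s t |s t. s \<in> mspace m \<and> t \<in> mspace m \<and> s \<noteq> t})"
  proof (rule bdd_aboveI)
    fix q assume "q \<in> insert 0 {\<bar>f s - f t\<bar> / mdist m s t |s t. s \<in> mspace m \<and> t \<in> mspace m \<and> s \<noteq> t}"
    then consider "q = 0" | s t where "q = \<bar>f s - f t\<bar> / mdist m s t" "s \<in> mspace m" "t \<in> mspace m" "s \<noteq> t"
      by blast
    then show "q \<le> max 0 C"
    proof cases
      case 2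
      with C[of s t] mdist_pos[of s m t] have "q \<le> C" by (simp add: pos_divide_le_eq)
      then show ?thesis by simp
    qed simp
  qed
  then have "\<bar>f s - f t\<bar> / mdist m s t \<le> N f"
    unfolding lip_norm_def using s False by (intro cSup_upper) auto
  with pos show ?thesis by (simp add: pos_divide_le_eq)
qed (use s in simp)

lemma lip_norm_nonneg: "f \<in> big \<Longrightarrow> 0 \<le> N f"
proof (cases "\<exists>s\<in>mspace m. s \<noteq> p")
  case True
  assume f: "f \<in> big"
  from True obtain s where s: "s \<in> mspace m" "s \<noteq> p" by blast
  then have "0 < mdist m s p" using base_point by (simp add: mdist_pos)
  moreover have "0 \<le> N f * mdist m s p"
    using lip_bound[OF f s(1) base_point] by linarith
  ultimately show ?thesis by (simp add: zero_le_mult_iff)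
next
  case False
  then have "s = t" if "s \<in> mspace m" "t \<in> mspace m" for s t using that by metis
  then have empty: "{\<bar>f s - f t\<bar> / mdist m s t |s t. s \<in> mspace m \<and> t \<in> mspace m \<and> s \<noteq> t} = {}"
    by blast
  show ?thesis unfolding lip_norm_def empty by simp
qed

lemma sup_bound: "f \<in> big \<Longrightarrow> s \<in> mspace m \<Longrightarrow> \<bar>f s\<bar> \<le> N f * mdist m s p"
  using lip_bound[OF _ _ base_point] big_base_point by force

lemma big_add:
  assumes "f \<in> big" "g \<in> big"
  shows "f + g \<in> big" "N (f + g) \<le> N f + N g"
proof -
  have b: "\<bar>(f + g) s - (f + g) t\<bar> \<le> (N f + N g) * mdist m s t"
    if "s \<in> mspace m" "t \<in> mspace m" for s t
    using lip_bound[OF assms(1) that] lip_bound[OF assms(2) that] by (simp add: distrib_right)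
  show "f + g \<in> big"
    by (rule Lip0I[OF b]) (use assms in \<open>auto simp: big_base_point big_outside\<close>)
  show "N (f + g) \<le> N f + N g"
    using lip_norm_nonneg[OF assms(1)] lip_norm_nonneg[OF assms(2)] b by (intro lip_norm_leI) auto
qed

lemma big_scale:
  assumes "f \<in> big"
  shows "c *\<^sub>R f \<in> big" "N (c *\<^sub>R f) \<le> \<bar>c\<bar> * N f"
proof -
  have b: "\<bar>(c *\<^sub>R f) s - (c *\<^sub>R f) t\<bar> \<le> (\<bar>c\<bar> * N f) * mdist m s t"
    if "s \<in> mspace m" "t \<in> mspace m" for s t
    using mult_left_mono[OF lip_bound[OF assms(1) that], of "\<bar>c\<bar>"]
    by (simp add: abs_mult[symmetric] right_diff_distrib mult.assoc)
  show "c *\<^sub>R f \<in> big"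
    by (rule Lip0I[OF b]) (use assms in \<open>auto simp: big_base_point big_outside\<close>)
  show "N (c *\<^sub>R f) \<le> \<bar>c\<bar> * N f"
    using lip_norm_nonneg[OF assms(1)] b by (intro lip_norm_leI) auto
qed

lemma subspace_big: "subspace big"
  unfolding subspace_def using big_add big_scale
  by (auto intro: Lip0I[of _ _ 0])

lemma normed_space_Lip0: "normed_space (Lip0 m p)"
proof -
  have scale: "N (c *\<^sub>R f) = \<bar>c\<bar> * N f" if f: "f \<in> big" for f c
  proof (cases "c = 0")
    case True
    with big_scale[OF f, of 0] lip_norm_nonneg[OF big_scale(1)[OF f, of 0]] show ?thesis by simp
  next
    case False
    have "N f \<le> \<bar>1 / c\<bar> * N (c *\<^sub>R f)"
      using big_scale(2)[OF big_scale(1)[OF f], of "1 / c" c] False by simp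
    then have "\<bar>c\<bar> * N f \<le> N (c *\<^sub>R f)"
      using False by (simp add: pos_le_divide_eq mult.commute)
    with big_scale(2)[OF f, of c] show ?thesis by simp
  qed
  have "f = 0" if f: "f \<in> big" "N f = 0" for f
  proof
    show "f s = 0 s" for s
      using sup_bound[OF f(1), of s] f(2) big_outside[OF f(1), of s] by fastforce
  qed
  moreover have "N 0 = 0"
    using scale[OF subspace_0[OF subspace_big], of 0] by simp
  ultimately have "\<forall>f\<in>big. N f = 0 \<longleftrightarrow> f = 0" by metis
  then show ?thesis
    unfolding normed_space_def nnorm_Lip0
    using subspace_big lip_norm_nonneg scale big_add(2) by simp
qed

lemma littleD:
  assumes "f \<in> little" "0 < e"
  obtains d where "0 < d"
    "\<And>s t. s \<in> mspace m \<Longrightarrow> t \<in> mspace m \<Longrightarrow> mdist m s t < d \<Longrightarrow> \<bar>f s - f t\<bar> \<le> e * mdist m s t"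
proof -
  obtain d where d: "0 < d" "\<And>s t. s \<in> mspace m \<Longrightarrow> t \<in> mspace m \<Longrightarrow> 0 < mdist m s t \<Longrightarrow>
      mdist m s t < d \<Longrightarrow> \<bar>f s - f t\<bar> \<le> e * mdist m s t"
    using assms by (auto simp: lip0_def)
  have "\<bar>f s - f t\<bar> \<le> e * mdist m s t" if "s \<in> mspace m" "t \<in> mspace m" "mdist m s t < d" for s t
    using d(2)[OF that(1,2)] that mdist_pos[OF that(1,2)] by (cases "s = t") simp_all
  with d(1) that show ?thesis by blast
qed

lemma littleI:
  assumes "f \<in> big"
    and "\<And>e. 0 < e \<Longrightarrow> \<exists>d>0. \<forall>s\<in>mspace m. \<forall>t\<in>mspace m. mdist m s t < d \<longrightarrow>
      \<bar>f s - f t\<bar> \<le> e * mdist m s t"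
  shows "f \<in> little"
proof -
  have "\<exists>d>0. \<forall>s\<in>mspace m. \<forall>t\<in>mspace m. 0 < mdist m s t \<and> mdist m s t < d \<longrightarrow>
      \<bar>f s - f t\<bar> \<le> e * mdist m s t" if "0 < e" for e
    using assms(2)[OF that] by blast
  with assms(1) show ?thesis by (simp add: lip0_def)
qed

text \<open>
  The modulus condition of lip0 passes to norm limits: it is inherited from an approximating
  function, at the price of half of \<open>e\<close>.
\<close>

lemma little_if_near_little:
  assumes F: "F \<in> big" and near: "\<And>e. 0 < e \<Longrightarrow> \<exists>f\<in>little. N (F - f) \<le> e"
  shows "F \<in> little"
proof (rule littleI[OF F])
  fix e :: real assume "0 < e"
  then obtain f where f: "f \<in> little" "N (F - f) \<le> e / 2" using near[of "e / 2"] by auto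
  obtain d where d: "0 < d"
    "\<And>s t. s \<in> mspace m \<Longrightarrow> t \<in> mspace m \<Longrightarrow> mdist m s t < d \<Longrightarrow> \<bar>f s - f t\<bar> \<le> e / 2 * mdist m s t"
    using littleD[OF f(1), of "e / 2"] \<open>0 < e\<close> by auto
  have "\<bar>F s - F t\<bar> \<le> e * mdist m s t" if st: "s \<in> mspace m" "t \<in> mspace m" "mdist m s t < d" for s t
  proof -
    have "F - f \<in> big" using F f little_imp_big subspace_diff[OF subspace_big] by blast
    then have "\<bar>(F - f) s - (F - f) t\<bar> \<le> N (F - f) * mdist m s t"
      using st lip_bound by blast
    also have "\<dots> \<le> e / 2 * mdist m s t" by (rule mult_right_mono[OF f(2) mdist_nonneg])
    finally have "\<bar>(F s - f s) - (F t - f t)\<bar> \<le> e / 2 * mdist m s t" by simp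
    with d(2)[OF st] show ?thesis by linarith
  qed
  with d(1) show "\<exists>d>0. \<forall>s\<in>mspace m. \<forall>t\<in>mspace m. mdist m s t < d \<longrightarrow> \<bar>F s - F t\<bar> \<le> e * mdist m s t"
    by blast
qed

lemma subspace_little: "subspace little"
  unfolding subspace_def
proof (intro conjI ballI allI)
  show "0 \<in> little"
  proof (rule littleI)
    fix e :: real assume "0 < e"
    then show "\<exists>d>0. \<forall>s\<in>mspace m. \<forall>t\<in>mspace m. mdist m s t < d \<longrightarrow>
        \<bar>(0 :: 'a \<Rightarrow> real) s - (0 :: 'a \<Rightarrow> real) t\<bar> \<le> e * mdist m s t"
      by (intro exI[of _ 1]) simp
  qed (rule subspace_0[OF subspace_big])
  fix f assume f: "f \<in> little"
  show "f + g \<in> little" if g: "g \<in> little" for g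
  proof (rule littleI)
    fix e :: real assume "0 < e"
    obtain d where d: "0 < d"
      "\<And>s t. s \<in> mspace m \<Longrightarrow> t \<in> mspace m \<Longrightarrow> mdist m s t < d \<Longrightarrow> \<bar>f s - f t\<bar> \<le> e / 2 * mdist m s t"
      using littleD[OF f, of "e / 2"] \<open>0 < e\<close> by auto
    obtain d' where d': "0 < d'"
      "\<And>s t. s \<in> mspace m \<Longrightarrow> t \<in> mspace m \<Longrightarrow> mdist m s t < d' \<Longrightarrow> \<bar>g s - g t\<bar> \<le> e / 2 * mdist m s t"
      using littleD[OF g, of "e / 2"] \<open>0 < e\<close> by auto
    have "\<bar>(f + g) s - (f + g) t\<bar> \<le> e * mdist m s t"
      if "s \<in> mspace m" "t \<in> mspace m" "mdist m s t < min d d'" for s t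
    proof -
      have "\<bar>f s - f t\<bar> \<le> e / 2 * mdist m s t" "\<bar>g s - g t\<bar> \<le> e / 2 * mdist m s t"
        using d(2) d'(2) that by simp_all
      then have "\<bar>(f s + g s) - (f t + g t)\<bar> \<le> e * mdist m s t" by linarith
      then show ?thesis by simp
    qed
    with d(1) d'(1) show "\<exists>d>0. \<forall>s\<in>mspace m. \<forall>t\<in>mspace m. mdist m s t < d \<longrightarrow>
        \<bar>(f + g) s - (f + g) t\<bar> \<le> e * mdist m s t"
      by (intro exI[of _ "min d d'"]) simp
  qed (use f g little_imp_big big_add in blast)
  show "c *\<^sub>R f \<in> little" for c
  proof (rule littleI)
    fix e :: real assume "0 < e"
    then obtain d where d: "0 < d" "\<And>s t. s \<in> mspace m \<Longrightarrow> t \<in> mspace m \<Longrightarrow> mdist m s t < d \<Longrightarrow>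
        \<bar>f s - f t\<bar> \<le> e / (\<bar>c\<bar> + 1) * mdist m s t"
      using littleD[OF f, of "e / (\<bar>c\<bar> + 1)"] by auto
    have "\<bar>(c *\<^sub>R f) s - (c *\<^sub>R f) t\<bar> \<le> e * mdist m s t"
      if "s \<in> mspace m" "t \<in> mspace m" "mdist m s t < d" for s t
    proof -
      have "\<bar>(c *\<^sub>R f) s - (c *\<^sub>R f) t\<bar> = \<bar>c\<bar> * \<bar>f s - f t\<bar>"
        by (simp add: abs_mult[symmetric] right_diff_distrib)
      also have "\<dots> \<le> (\<bar>c\<bar> + 1) * (e / (\<bar>c\<bar> + 1) * mdist m s t)"
        using d(2)[OF that] by (intro mult_mono) auto
      also have "\<dots> = e * mdist m s t"
        using abs_ge_zero[of c] by (simp add: field_simps)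
      finally show ?thesis .
    qed
    with d(1) show "\<exists>d>0. \<forall>s\<in>mspace m. \<forall>t\<in>mspace m. mdist m s t < d \<longrightarrow>
        \<bar>(c *\<^sub>R f) s - (c *\<^sub>R f) t\<bar> \<le> e * mdist m s t"
      by blast
  qed (use f little_imp_big big_scale in blast)
qed

lemma normed_space_lip0: "normed_space (lip0 m p)"
  unfolding normed_space_def nnorm_lip0
  using subspace_little nnorm_nonneg[OF normed_space_Lip0 little_imp_big]
    nnorm_eq_0_iff[OF normed_space_Lip0 little_imp_big]
    nnorm_scale[OF normed_space_Lip0 little_imp_big]
    nnorm_triangle[OF normed_space_Lip0 little_imp_big little_imp_big]
  unfolding nnorm_Lip0 by blast

text \<open>
  A Cauchy sequence in Lip0 converges pointwise, since \<open>\<bar>f s\<bar>\<close> is at most the norm of \<open>f\<close> times the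
  distance from \<open>s\<close> to the base point. The Lipschitz estimates for the differences of its members
  survive the pointwise limit, which gives convergence in norm.
\<close>

lemma banach_space_Lip0: "banach_space (Lip0 m p)"
proof -
  interpret B: Metric_space big "ndist (Lip0 m p)"
    by (rule Metric_space_ndist[OF normed_space_Lip0])
  have "\<exists>F. limitin B.mtopology \<sigma> F sequentially" if \<sigma>: "B.MCauchy \<sigma>" for \<sigma>
  proof -
    have \<sigma>_in: "\<sigma> n \<in> big" for n using \<sigma> unfolding B.MCauchy_def by blast
    have diff_in: "\<sigma> n - \<sigma> k \<in> big" for n k using \<sigma>_in subspace_diff[OF subspace_big] by blast
    have Cauchy: "\<exists>k. \<forall>n\<ge>k. \<forall>j\<ge>k. N (\<sigma> n - \<sigma> j) < e" if "0 < e" for e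
      using \<sigma> that \<sigma>_in unfolding B.MCauchy_def ndist_def by simp
    have conv: "convergent (\<lambda>n. \<sigma> n s)" for s
    proof (cases "s \<in> mspace m")
      case True
      have "Cauchy (\<lambda>n. \<sigma> n s)"
      proof (rule CauchyI)
        fix e :: real assume "0 < e"
        have pos: "0 < mdist m s p + 1" by (simp add: add_nonneg_pos)
        then obtain k where k: "\<And>n j. k \<le> n \<Longrightarrow> k \<le> j \<Longrightarrow> N (\<sigma> n - \<sigma> j) < e / (mdist m s p + 1)"
          using Cauchy[of "e / (mdist m s p + 1)"] \<open>0 < e\<close> by auto
        have "norm (\<sigma> n s - \<sigma> j s) < e" if "k \<le> n" "k \<le> j" for n j
        proof -
          have "\<bar>(\<sigma> n - \<sigma> j) s\<bar> \<le> N (\<sigma> n - \<sigma> j) * mdist m s p"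
            by (rule sup_bound[OF diff_in True])
          also have "\<dots> \<le> N (\<sigma> n - \<sigma> j) * (mdist m s p + 1)"
            by (intro mult_left_mono lip_norm_nonneg diff_in) simp
          also have "\<dots> < e"
            using k[OF that] pos by (simp add: pos_less_divide_eq)
          finally show ?thesis by simp
        qed
        then show "\<exists>M. \<forall>m\<ge>M. \<forall>n\<ge>M. norm (\<sigma> m s - \<sigma> n s) < e" by blast
      qed
      then show ?thesis by (simp add: Cauchy_convergent_iff)
    qed (simp add: big_outside[OF \<sigma>_in] convergent_const)
    define F where "F s = lim (\<lambda>n. \<sigma> n s)" for s
    have lim: "(\<lambda>n. \<sigma> n s) \<longlonglongrightarrow> F s" for s
      using conv[of s] unfolding F_def convergent_LIMSEQ_iff .
    have close: "\<exists>k. \<forall>n\<ge>k. \<sigma> n - F \<in> big \<and> N (\<sigma> n - F) \<le> e" if "0 < e" for e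
    proof -
      obtain k where k: "\<And>n j. k \<le> n \<Longrightarrow> k \<le> j \<Longrightarrow> N (\<sigma> n - \<sigma> j) < e"
        using Cauchy[OF \<open>0 < e\<close>] by blast
      have "\<sigma> n - F \<in> big \<and> N (\<sigma> n - F) \<le> e" if n: "k \<le> n" for n
      proof -
        have b: "\<bar>(\<sigma> n - F) s - (\<sigma> n - F) t\<bar> \<le> e * mdist m s t"
          if st: "s \<in> mspace m" "t \<in> mspace m" for s t
        proof (rule LIMSEQ_le_const2)
          show "(\<lambda>j. \<bar>(\<sigma> n s - \<sigma> j s) - (\<sigma> n t - \<sigma> j t)\<bar>) \<longlonglongrightarrow> \<bar>(\<sigma> n - F) s - (\<sigma> n - F) t\<bar>"
            by (auto intro!: tendsto_intros lim)
          have "\<bar>(\<sigma> n s - \<sigma> j s) - (\<sigma> n t - \<sigma> j t)\<bar> \<le> e * mdist m s t" if "k \<le> j" for j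
            using lip_bound[OF diff_in[of n j] st] k[OF n that]
              mult_right_mono[of "N (\<sigma> n - \<sigma> j)" e "mdist m s t"] by simp
          then show "\<exists>J. \<forall>j\<ge>J. \<bar>(\<sigma> n s - \<sigma> j s) - (\<sigma> n t - \<sigma> j t)\<bar> \<le> e * mdist m s t"
            by blast
        qed
        have z: "F p = 0" "s \<notin> mspace m \<Longrightarrow> F s = 0" for s
          by (simp_all add: F_def big_base_point[OF \<sigma>_in] big_outside[OF \<sigma>_in])
        show ?thesis
          using b \<open>0 < e\<close> by (intro conjI Lip0I[OF b] lip_norm_leI)
            (simp_all add: z big_base_point[OF \<sigma>_in] big_outside[OF \<sigma>_in])
      qed
      then show ?thesis by blast
    qed
    obtain n where "\<sigma> n - F \<in> big" using close[of 1] by auto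
    then have "\<sigma> n - (\<sigma> n - F) \<in> big" using \<sigma>_in subspace_diff[OF subspace_big] by blast
    then have F: "F \<in> big" by simp
    have "\<exists>k. \<forall>n\<ge>k. \<sigma> n \<in> big \<and> ndist (Lip0 m p) (\<sigma> n) F < e" if e: "0 < e" for e
    proof -
      obtain k where k: "\<And>n. k \<le> n \<Longrightarrow> N (\<sigma> n - F) \<le> e / 2" using close[of "e / 2"] e by auto
      have "\<sigma> n \<in> big \<and> ndist (Lip0 m p) (\<sigma> n) F < e" if "k \<le> n" for n
        using k[OF that] e \<sigma>_in[of n] F by (simp add: ndist_def)
      then show ?thesis by blast
    qed
    with F have "limitin B.mtopology \<sigma> F sequentially"
      by (simp add: B.limitin_metric eventually_sequentially)
    then show ?thesis by blast
  qed
  then show ?thesis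
    using normed_space_Lip0 by (simp add: banach_space_def B.mcomplete_def)
qed

lemma closed_subspace_lip0: "closed_subspace little (Lip0 m p)"
proof -
  interpret B: Metric_space big "ndist (Lip0 m p)"
    by (rule Metric_space_ndist[OF normed_space_Lip0])
  have "F \<in> little" if \<sigma>: "range \<sigma> \<subseteq> little" and F: "limitin B.mtopology \<sigma> F sequentially" for \<sigma> F
  proof (rule little_if_near_little)
    show "F \<in> big" using F B.limitin_mspace by blast
    fix e :: real assume "0 < e"
    then obtain n where n: "\<sigma> n \<in> big" "ndist (Lip0 m p) (\<sigma> n) F < e"
      using F by (auto simp: B.limitin_metric eventually_sequentially)
    then have "ndist (Lip0 m p) F (\<sigma> n) < e"
      by (simp add: B.commute)
    with n \<open>F \<in> big\<close> have "N (F - \<sigma> n) \<le> e" by (simp add: ndist_def)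
    with \<sigma> show "\<exists>f\<in>little. N (F - f) \<le> e" by blast
  qed
  then have "closedin B.mtopology little"
    unfolding B.metric_closedin_iff_sequentially_closed using little_imp_big by blast
  then show ?thesis
    using subspace_little little_imp_big by (auto simp: closed_subspace_def)
qed

end

section \<open>Uniformly small functions against a fixed little function\<close>

context pointed_metric
begin

lemma big_diff: "f \<in> big \<Longrightarrow> g \<in> big \<Longrightarrow> f - g \<in> big"
  using subspace_diff[OF subspace_big] by blast

lemma little_diff: "f \<in> little \<Longrightarrow> g \<in> little \<Longrightarrow> f - g \<in> little"
  using subspace_diff[OF subspace_little] by blast

lemma norm_diff_le:
  assumes "f \<in> big" "g \<in> big"
  shows "N (f - g) \<le> N f + N g"
  using nnorm_triangle[OF normed_space_Lip0, of f "- g"] nnorm_minus[OF normed_space_Lip0, of g]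
    assms subspace_neg[OF subspace_big] by simp

text \<open>
  The norm of a sum is almost a maximum. At small distances the difference quotients of \<open>f\<close> are
  negligible and those of \<open>g\<close> are bounded by \<open>N g\<close>; at large distances the difference quotients
  of \<open>g\<close> are negligible because \<open>g\<close> is uniformly small. This resemblance to the sup norm
  on the space of null sequences is the source of both halves of the result.
\<close>

lemma norm_little_add_small:
  assumes f: "f \<in> little" and e: "0 < e"
  obtains \<eta> where "0 < \<eta>"
    "\<And>g. g \<in> big \<Longrightarrow> (\<And>s. s \<in> mspace m \<Longrightarrow> \<bar>g s\<bar> \<le> \<eta>) \<Longrightarrow> N (f + g) \<le> max (N f) (N g) + e"
proof -
  obtain d where d: "0 < d"
    "\<And>s t. s \<in> mspace m \<Longrightarrow> t \<in> mspace m \<Longrightarrow> mdist m s t < d \<Longrightarrow> \<bar>f s - f t\<bar> \<le> e * mdist m s t"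
    using littleD[OF f e] by blast
  have "N (f + g) \<le> max (N f) (N g) + e"
    if g: "g \<in> big" and small: "\<And>s. s \<in> mspace m \<Longrightarrow> \<bar>g s\<bar> \<le> e * d / 2" for g
  proof (rule lip_norm_leI)
    show "0 \<le> max (N f) (N g) + e"
      using e lip_norm_nonneg[OF g] by linarith
    fix s t assume st: "s \<in> mspace m" "t \<in> mspace m"
    let ?D = "mdist m s t"
    have mx: "N f * ?D \<le> max (N f) (N g) * ?D" "N g * ?D \<le> max (N f) (N g) * ?D"
      by (intro mult_right_mono; simp)+
    have "\<bar>f s - f t\<bar> + \<bar>g s - g t\<bar> \<le> max (N f) (N g) * ?D + e * ?D"
    proof (cases "?D < d")
      case True
      show ?thesis
        using d(2)[OF st True] lip_bound[OF g st] mx(2) by linarith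
    next
      case False
      then have "e * d \<le> e * ?D" using e by simp
      then show ?thesis
        using small[OF st(1)] small[OF st(2)] lip_bound[OF little_imp_big[OF f] st] mx(1) by linarith
    qed
    then have "\<bar>(f s + g s) - (f t + g t)\<bar> \<le> max (N f) (N g) * ?D + e * ?D" by linarith
    then show "\<bar>(f + g) s - (f + g) t\<bar> \<le> (max (N f) (N g) + e) * ?D"
      by (simp add: distrib_right)
  qed
  with d(1) e that[of "e * d / 2"] show thesis by simp
qed

text \<open>
  A gliding hump argument. If uniformly small functions of the unit ball of lip0 did not have small
  values under \<open>\<phi>\<close>, humps with values above \<open>e\<close> could be added one by one, each so small uniformly
  that the norm of the sum stays below 2. The values of \<open>\<phi>\<close> on these sums would be unbounded.
\<close>

lemma little_functional_small_unit:
  assumes \<phi>: "\<phi> \<in> nvecs (dual (lip0 m p))" and e: "0 < e"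
  shows "\<exists>\<eta>>0. \<forall>f\<in>little. N f \<le> 1 \<longrightarrow> (\<forall>s\<in>mspace m. \<bar>f s\<bar> \<le> \<eta>) \<longrightarrow> \<bar>\<phi> f\<bar> \<le> e"
proof (rule ccontr)
  assume contr: "\<not> ?thesis"
  have hump: "\<exists>f\<in>little. N f \<le> 1 \<and> (\<forall>s\<in>mspace m. \<bar>f s\<bar> \<le> \<eta>) \<and> e < \<phi> f" if "0 < \<eta>" for \<eta>
  proof -
    obtain f where f: "f \<in> little" "N f \<le> 1" "\<And>s. s \<in> mspace m \<Longrightarrow> \<bar>f s\<bar> \<le> \<eta>" "e < \<bar>\<phi> f\<bar>"
      using contr \<open>0 < \<eta>\<close> by (meson not_le)
    show ?thesis
    proof (cases "0 \<le> \<phi> f")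
      case True
      with f show ?thesis by auto
    next
      case False
      with f show ?thesis
        using dual_minus[OF normed_space_lip0 \<phi>, of f] nnorm_minus[OF normed_space_lip0, of f]
          subspace_neg[OF subspace_little f(1)] by (intro bexI[of _ "- f"]) simp_all
    qed
  qed
  have sums: "\<exists>h\<in>little. N h < 2 \<and> real k * e \<le> \<phi> h" for k
  proof (induction k)
    case 0
    have "N 0 < 2" "real 0 * e \<le> \<phi> 0"
      using nnorm_zero[OF normed_space_lip0] dual_zero[OF normed_space_lip0 \<phi>] by simp_all
    then show ?case
      using subspace_0[OF subspace_little] by blast
  next
    case (Suc k)
    then obtain h where h: "h \<in> little" "N h < 2" "real k * e \<le> \<phi> h" by blast
    \<comment> \<open>Half of the room that is left below 2, so that the bound survives infinitely many steps.\<close>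
    let ?r = "(2 - max (N h) 1) / 2"
    have r: "0 < ?r" using h(2) by simp
    obtain \<eta> where \<eta>: "0 < \<eta>"
      "\<And>g. g \<in> big \<Longrightarrow> (\<And>s. s \<in> mspace m \<Longrightarrow> \<bar>g s\<bar> \<le> \<eta>) \<Longrightarrow> N (h + g) \<le> max (N h) (N g) + ?r"
      using norm_little_add_small[OF h(1) r] by blast
    obtain f where f: "f \<in> little" "N f \<le> 1" "\<And>s. s \<in> mspace m \<Longrightarrow> \<bar>f s\<bar> \<le> \<eta>" "e < \<phi> f"
      using hump[OF \<eta>(1)] by blast
    have "N (h + f) \<le> max (N h) (N f) + ?r"
      using \<eta>(2)[OF little_imp_big[OF f(1)] f(3)] by simp
    then have "N (h + f) < 2" using f(2) h(2) unfolding max_def by (simp add: field_simps split: if_splits)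
    moreover have "h + f \<in> little" using h f subspace_add[OF subspace_little] by blast
    moreover have "real (Suc k) * e \<le> \<phi> (h + f)"
      using h f dual_add[OF \<phi>, of h f] by (simp add: distrib_right)
    ultimately show ?case by blast
  qed
  let ?B = "nnorm (dual (lip0 m p)) \<phi>"
  have "0 \<le> ?B" by (rule nnorm_nonneg[OF normed_space_dual[OF normed_space_lip0] \<phi>])
  obtain k :: nat where k: "2 * ?B / e < real k" using reals_Archimedean2 by blast
  obtain h where h: "h \<in> little" "N h < 2" "real k * e \<le> \<phi> h" using sums by blast
  have "\<phi> h \<le> ?B * N h"
    using dual_norm_bound[OF normed_space_lip0 \<phi> h(1)] by simp
  also have "\<dots> \<le> ?B * 2" using h(2) \<open>0 \<le> ?B\<close> by (intro mult_left_mono) auto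
  finally show False using h(3) k e by (simp add: pos_divide_less_eq)
qed

lemma little_functional_small:
  assumes \<phi>: "\<phi> \<in> nvecs (dual (lip0 m p))" and e: "0 < e"
  obtains \<eta> where "0 < \<eta>"
    "\<And>f. f \<in> little \<Longrightarrow> N f \<le> C \<Longrightarrow> (\<And>s. s \<in> mspace m \<Longrightarrow> \<bar>f s\<bar> \<le> \<eta>) \<Longrightarrow> \<bar>\<phi> f\<bar> \<le> e"
proof -
  define K where "K = max C 1"
  have K: "0 < K" "C \<le> K" by (simp_all add: K_def)
  obtain \<eta> where \<eta>: "0 < \<eta>"
    "\<And>f. f \<in> little \<Longrightarrow> N f \<le> 1 \<Longrightarrow> (\<And>s. s \<in> mspace m \<Longrightarrow> \<bar>f s\<bar> \<le> \<eta>) \<Longrightarrow> \<bar>\<phi> f\<bar> \<le> e / K"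
    using little_functional_small_unit[OF \<phi> divide_pos_pos[OF e K(1)]] by blast
  have "\<bar>\<phi> f\<bar> \<le> e"
    if f: "f \<in> little" "N f \<le> C" "\<And>s. s \<in> mspace m \<Longrightarrow> \<bar>f s\<bar> \<le> K * \<eta>" for f
  proof -
    let ?f = "(1 / K) *\<^sub>R f"
    have "?f \<in> little" by (rule subspace_scale[OF subspace_little f(1)])
    moreover have "N ?f \<le> 1"
      using nnorm_scale[OF normed_space_lip0 f(1), of "1 / K"] f(2) K by simp
    moreover have "\<bar>?f s\<bar> \<le> \<eta>" if "s \<in> mspace m" for s
      using f(3)[OF that] K(1) by (simp add: pos_divide_le_eq mult.commute)
    ultimately have "\<bar>\<phi> ?f\<bar> \<le> e / K" by (rule \<eta>(2))
    then show ?thesis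
      using dual_scale[OF \<phi> , of f "1 / K"] f(1) K(1) by (simp add: divide_le_cancel)
  qed
  with \<eta>(1) K(1) that[of "K * \<eta>"] show thesis by simp
qed

end

section \<open>Extending functionals from lip0 to Lip0\<close>

text \<open>
  The one property of a snowflaked metric that the argument uses: every function in Lip0 is a uniform
  limit of functions in lip0 whose norms do not exceed its own.
\<close>

locale approximable_metric = pointed_metric +
  assumes approximable: "F \<in> big \<Longrightarrow> 0 < \<eta> \<Longrightarrow>
    \<exists>f\<in>little. N f \<le> N F \<and> (\<forall>s\<in>mspace m. \<bar>F s - f s\<bar> \<le> \<eta>)"
begin

text \<open>
  On norm-bounded sequences, uniform convergence plays the role of weak-star convergence in the bidual.
  The rate \<open>r\<close> makes it easy to combine two such sequences.
\<close>

definition bounded_limit :: "(nat \<Rightarrow> 'a \<Rightarrow> real) \<Rightarrow> ('a \<Rightarrow> real) \<Rightarrow> bool"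
  where "bounded_limit g F \<longleftrightarrow> (\<forall>n. g n \<in> little) \<and> (\<exists>C. \<forall>n. N (g n) \<le> C) \<and>
    (\<exists>r. r \<longlonglongrightarrow> 0 \<and> (\<forall>n. \<forall>s\<in>mspace m. \<bar>g n s - F s\<bar> \<le> r n))"

lemma bounded_limitI:
  assumes "\<And>n. g n \<in> little" "\<And>n. N (g n) \<le> C" "r \<longlonglongrightarrow> 0"
    "\<And>n s. s \<in> mspace m \<Longrightarrow> \<bar>g n s - F s\<bar> \<le> r n"
  shows "bounded_limit g F"
  using assms unfolding bounded_limit_def by blast

lemma bounded_limit_add:
  assumes "bounded_limit f F" "bounded_limit g G"
  shows "bounded_limit (\<lambda>n. f n + g n) (F + G)"
proof -
  obtain C r where f: "\<And>n. f n \<in> little" "\<And>n. N (f n) \<le> C" "r \<longlonglongrightarrow> 0"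
    "\<And>n s. s \<in> mspace m \<Longrightarrow> \<bar>f n s - F s\<bar> \<le> r n"
    using assms(1) unfolding bounded_limit_def by blast
  obtain C' r' where g: "\<And>n. g n \<in> little" "\<And>n. N (g n) \<le> C'" "r' \<longlonglongrightarrow> 0"
    "\<And>n s. s \<in> mspace m \<Longrightarrow> \<bar>g n s - G s\<bar> \<le> r' n"
    using assms(2) unfolding bounded_limit_def by blast
  show ?thesis
  proof (rule bounded_limitI)
    show "f n + g n \<in> little" for n using f g subspace_add[OF subspace_little] by blast
    show "N (f n + g n) \<le> C + C'" for n
      using big_add(2)[OF little_imp_big[OF f(1)] little_imp_big[OF g(1)], of n n] f(2)[of n] g(2)[of n]
      by linarith
    show "(\<lambda>n. r n + r' n) \<longlonglongrightarrow> 0" using tendsto_add[OF f(3) g(3)] by simp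
    show "\<bar>(f n + g n) s - (F + G) s\<bar> \<le> r n + r' n" if "s \<in> mspace m" for n s
      using f(4)[OF that, of n] g(4)[OF that, of n] unfolding plus_fun_apply by linarith
  qed
qed

lemma bounded_limit_scale:
  assumes "bounded_limit f F"
  shows "bounded_limit (\<lambda>n. c *\<^sub>R f n) (c *\<^sub>R F)"
proof -
  obtain C r where f: "\<And>n. f n \<in> little" "\<And>n. N (f n) \<le> C" "r \<longlonglongrightarrow> 0"
    "\<And>n s. s \<in> mspace m \<Longrightarrow> \<bar>f n s - F s\<bar> \<le> r n"
    using assms(1) unfolding bounded_limit_def by blast
  show ?thesis
  proof (rule bounded_limitI)
    show "c *\<^sub>R f n \<in> little" for n using f subspace_scale[OF subspace_little] by blast
    show "N (c *\<^sub>R f n) \<le> \<bar>c\<bar> * C" for n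
      using big_scale(2)[OF little_imp_big[OF f(1)], of c n] mult_left_mono[OF f(2)[of n], of "\<bar>c\<bar>"]
      by linarith
    show "(\<lambda>n. \<bar>c\<bar> * r n) \<longlonglongrightarrow> 0" using tendsto_mult_left[OF f(3), of "\<bar>c\<bar>"] by simp
    show "\<bar>(c *\<^sub>R f n) s - (c *\<^sub>R F) s\<bar> \<le> \<bar>c\<bar> * r n" if "s \<in> mspace m" for n s
      using mult_left_mono[OF f(4)[OF that, of n], of "\<bar>c\<bar>"]
      by (simp add: abs_mult[symmetric] right_diff_distrib)
  qed
qed

lemma bounded_limit_diff:
  assumes "bounded_limit f F" "bounded_limit g G"
  shows "bounded_limit (\<lambda>n. f n - g n) (F - G)"
  using bounded_limit_add[OF assms(1) bounded_limit_scale[OF assms(2), of "-1"]] by simp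

lemma bounded_limit_const: "f \<in> little \<Longrightarrow> bounded_limit (\<lambda>n. f) f"
  by (rule bounded_limitI[of _ "N f" "\<lambda>n. 0"]) auto

lemma functional_bounded_limit_zero:
  assumes \<phi>: "\<phi> \<in> nvecs (dual (lip0 m p))" and h: "bounded_limit h 0"
  shows "(\<lambda>n. \<phi> (h n)) \<longlonglongrightarrow> 0"
proof (rule LIMSEQ_I)
  fix e :: real assume "0 < e"
  obtain C r where h: "\<And>n. h n \<in> little" "\<And>n. N (h n) \<le> C" "r \<longlonglongrightarrow> 0"
    and hr: "\<And>n s. s \<in> mspace m \<Longrightarrow> \<bar>h n s - 0 s\<bar> \<le> r n"
    using h unfolding bounded_limit_def by blast
  obtain \<eta> where \<eta>: "0 < \<eta>"
    "\<And>f. f \<in> little \<Longrightarrow> N f \<le> C \<Longrightarrow> (\<And>s. s \<in> mspace m \<Longrightarrow> \<bar>f s\<bar> \<le> \<eta>) \<Longrightarrow> \<bar>\<phi> f\<bar> \<le> e / 2"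
    using little_functional_small[OF \<phi>, of "e / 2" C] \<open>0 < e\<close> by auto
  obtain k where k: "\<And>n. k \<le> n \<Longrightarrow> norm (r n - 0) < \<eta>"
    using LIMSEQ_D[OF h(3) \<eta>(1)] by blast
  have "norm (\<phi> (h n) - 0) < e" if n: "k \<le> n" for n
  proof -
    have "\<bar>\<phi> (h n)\<bar> \<le> e / 2"
      by (rule \<eta>(2)[OF h(1,2)]) (use hr[of _ n] k[OF n] in force)
    then show ?thesis using \<open>0 < e\<close> by simp
  qed
  then show "\<exists>k. \<forall>n\<ge>k. norm (\<phi> (h n) - 0) < e" by blast
qed

definition approximant :: "('a \<Rightarrow> real) \<Rightarrow> nat \<Rightarrow> 'a \<Rightarrow> real"
  where "approximant F n = (SOME f. f \<in> little \<and> N f \<le> N F \<and>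
    (\<forall>s\<in>mspace m. \<bar>F s - f s\<bar> \<le> inverse (real (Suc n))))"

lemma approximant:
  assumes "F \<in> big"
  shows "approximant F n \<in> little" "N (approximant F n) \<le> N F"
    "s \<in> mspace m \<Longrightarrow> \<bar>F s - approximant F n s\<bar> \<le> inverse (real (Suc n))"
proof -
  have "\<exists>f. f \<in> little \<and> N f \<le> N F \<and> (\<forall>s\<in>mspace m. \<bar>F s - f s\<bar> \<le> inverse (real (Suc n)))"
    using approximable[OF assms, of "inverse (real (Suc n))"] by auto
  from someI_ex[OF this] show "approximant F n \<in> little" "N (approximant F n) \<le> N F"
    "s \<in> mspace m \<Longrightarrow> \<bar>F s - approximant F n s\<bar> \<le> inverse (real (Suc n))"
    unfolding approximant_def by blast+
qed

lemma bounded_limit_approximant: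
  assumes "F \<in> big"
  shows "bounded_limit (approximant F) F"
  by (rule bounded_limitI[OF approximant(1,2) LIMSEQ_inverse_real_of_nat])
    (use assms approximant(3)[OF assms] in \<open>auto simp: abs_minus_commute\<close>)

definition lip_extension :: "(('a \<Rightarrow> real) \<Rightarrow> real) \<Rightarrow> ('a \<Rightarrow> real) \<Rightarrow> real"
  where "lip_extension \<phi> F = (if F \<in> big then lim (\<lambda>n. \<phi> (approximant F n)) else 0)"

text \<open>
  Two bounded sequences in lip0 with the same uniform limit have uniformly small differences, so
  \<open>\<phi>\<close> tends to the same value along both of them by the gliding hump. Hence the extension
  does not depend on the approximants that were chosen, which gives its linearity.
\<close>

lemma functional_tendsto_lip_extension:
  assumes \<phi>: "\<phi> \<in> nvecs (dual (lip0 m p))" and F: "F \<in> big" and g: "bounded_limit g F"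
  shows "(\<lambda>n. \<phi> (g n)) \<longlonglongrightarrow> lip_extension \<phi> F"
proof -
  let ?f = "approximant F"
  note f = approximant[OF F]
  have "Cauchy (\<lambda>n. \<phi> (?f n))"
  proof (rule CauchyI)
    fix e :: real assume "0 < e"
    obtain \<eta> where \<eta>: "0 < \<eta>"
      "\<And>h. h \<in> little \<Longrightarrow> N h \<le> 2 * N F \<Longrightarrow> (\<And>s. s \<in> mspace m \<Longrightarrow> \<bar>h s\<bar> \<le> \<eta>) \<Longrightarrow> \<bar>\<phi> h\<bar> \<le> e / 2"
      using little_functional_small[OF \<phi>, of "e / 2" "2 * N F"] \<open>0 < e\<close> by auto
    obtain k where k: "inverse (real (Suc k)) < \<eta> / 2"
      using reals_Archimedean[of "\<eta> / 2"] \<eta>(1) by auto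
    have "norm (\<phi> (?f i) - \<phi> (?f j)) < e" if ij: "k \<le> i" "k \<le> j" for i j
    proof -
      have le: "inverse (real (Suc i)) \<le> \<eta> / 2" if "k \<le> i" for i
      proof -
        have "inverse (real (Suc i)) \<le> inverse (real (Suc k))" using that by simp
        with k show ?thesis by linarith
      qed
      have "\<bar>\<phi> (?f i - ?f j)\<bar> \<le> e / 2"
      proof (rule \<eta>(2)[OF little_diff[OF f(1) f(1)]])
        show "N (?f i - ?f j) \<le> 2 * N F"
          using norm_diff_le[OF little_imp_big[OF f(1)] little_imp_big[OF f(1)], of i j] f(2)[of i] f(2)[of j]
          by linarith
        show "\<bar>(?f i - ?f j) s\<bar> \<le> \<eta>" if "s \<in> mspace m" for s
        proof -
          have "\<bar>?f i s - ?f j s\<bar> \<le> \<eta>"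
            using f(3)[OF that, of i] f(3)[OF that, of j] le[OF ij(1)] le[OF ij(2)] by linarith
          then show ?thesis by simp
        qed
      qed
      then show ?thesis
        using dual_diff[OF normed_space_lip0 \<phi> f(1) f(1)] \<open>0 < e\<close> by simp
    qed
    then show "\<exists>k. \<forall>i\<ge>k. \<forall>j\<ge>k. norm (\<phi> (?f i) - \<phi> (?f j)) < e" by blast
  qed
  then have lim: "(\<lambda>n. \<phi> (?f n)) \<longlonglongrightarrow> lip_extension \<phi> F"
    using F by (simp add: lip_extension_def Cauchy_convergent_iff convergent_LIMSEQ_iff)
  have "(\<lambda>n. \<phi> (g n - ?f n)) \<longlonglongrightarrow> 0"
    using functional_bounded_limit_zero[OF \<phi>]
      bounded_limit_diff[OF g bounded_limit_approximant[OF F]] by simp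
  then have "(\<lambda>n. \<phi> (g n - ?f n) + \<phi> (?f n)) \<longlonglongrightarrow> 0 + lip_extension \<phi> F"
    using lim by (rule tendsto_add)
  moreover have "\<phi> (g n - ?f n) + \<phi> (?f n) = \<phi> (g n)" for n
    using g f(1) by (simp add: bounded_limit_def dual_diff[OF normed_space_lip0 \<phi>])
  ultimately show ?thesis by simp
qed

lemma lip_extension_little:
  assumes "\<phi> \<in> nvecs (dual (lip0 m p))" "f \<in> little"
  shows "lip_extension \<phi> f = \<phi> f"
  using functional_tendsto_lip_extension[OF assms(1) little_imp_big[OF assms(2)] bounded_limit_const[OF assms(2)]]
  by (simp add: LIMSEQ_const_iff)

lemma linear_map_on_lip_extension:
  assumes \<phi>: "\<phi> \<in> nvecs (dual (lip0 m p))"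
  shows "linear_map_on big (lip_extension \<phi>)"
  unfolding linear_map_on_def
proof (intro conjI ballI allI)
  note lim = functional_tendsto_lip_extension[OF \<phi>]
  fix F c assume F: "F \<in> big"
  show "lip_extension \<phi> (F + G) = lip_extension \<phi> F + lip_extension \<phi> G" if G: "G \<in> big" for G
  proof (rule LIMSEQ_unique)
    show "(\<lambda>n. \<phi> (approximant F n + approximant G n)) \<longlonglongrightarrow> lip_extension \<phi> (F + G)"
      using F G by (intro lim big_add bounded_limit_add bounded_limit_approximant)
    show "(\<lambda>n. \<phi> (approximant F n + approximant G n)) \<longlonglongrightarrow> lip_extension \<phi> F + lip_extension \<phi> G"
      using tendsto_add[OF lim[OF F bounded_limit_approximant[OF F]] lim[OF G bounded_limit_approximant[OF G]]]
      by (simp add: dual_add[OF \<phi>] approximant F G)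
  qed
  show "lip_extension \<phi> (c *\<^sub>R F) = c *\<^sub>R lip_extension \<phi> F"
  proof (rule LIMSEQ_unique)
    show "(\<lambda>n. \<phi> (c *\<^sub>R approximant F n)) \<longlonglongrightarrow> lip_extension \<phi> (c *\<^sub>R F)"
      using F by (intro lim big_scale bounded_limit_scale bounded_limit_approximant)
    show "(\<lambda>n. \<phi> (c *\<^sub>R approximant F n)) \<longlonglongrightarrow> c *\<^sub>R lip_extension \<phi> F"
      using tendsto_scaleR[OF tendsto_const lim[OF F bounded_limit_approximant[OF F]], of c]
      by (simp add: dual_scale[OF \<phi>] approximant F)
  qed
qed

text \<open>
  The approximants have norm at most \<open>N F\<close>, so that the extension has no larger norm than \<open>\<phi>\<close>.
\<close>

lemma lip_extension_bound:
  assumes \<phi>: "\<phi> \<in> nvecs (dual (lip0 m p))" and F: "F \<in> big"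
  shows "\<bar>lip_extension \<phi> F\<bar> \<le> nnorm (dual (lip0 m p)) \<phi> * N F"
proof (rule LIMSEQ_le_const2)
  show "(\<lambda>n. \<bar>\<phi> (approximant F n)\<bar>) \<longlonglongrightarrow> \<bar>lip_extension \<phi> F\<bar>"
    by (intro tendsto_rabs functional_tendsto_lip_extension[OF \<phi> F] bounded_limit_approximant[OF F])
  have "\<bar>\<phi> (approximant F n)\<bar> \<le> nnorm (dual (lip0 m p)) \<phi> * N F" for n
  proof -
    have "\<bar>\<phi> (approximant F n)\<bar> \<le> nnorm (dual (lip0 m p)) \<phi> * N (approximant F n)"
      using dual_norm_bound[OF normed_space_lip0 \<phi> approximant(1)[OF F]] by simp
    also have "\<dots> \<le> nnorm (dual (lip0 m p)) \<phi> * N F"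
      by (intro mult_left_mono approximant(2)[OF F] nnorm_nonneg[OF normed_space_dual[OF normed_space_lip0] \<phi>])
    finally show ?thesis .
  qed
  then show "\<exists>k. \<forall>n\<ge>k. \<bar>\<phi> (approximant F n)\<bar> \<le> nnorm (dual (lip0 m p)) \<phi> * N F" by blast
qed

lemma lip_extension_in_dual:
  assumes "\<phi> \<in> nvecs (dual (lip0 m p))"
  shows "lip_extension \<phi> \<in> nvecs (dual (Lip0 m p))"
  by (rule dualI[OF linear_map_on_lip_extension[OF assms]])
    (use lip_extension_bound[OF assms] in \<open>auto simp: lip_extension_def\<close>)

lemma lip_extension_small:
  assumes \<phi>: "\<phi> \<in> nvecs (dual (lip0 m p))" and e: "0 < e"
  obtains \<eta> where "0 < \<eta>"
    "\<And>F. F \<in> big \<Longrightarrow> N F \<le> C \<Longrightarrow> (\<And>s. s \<in> mspace m \<Longrightarrow> \<bar>F s\<bar> \<le> \<eta>) \<Longrightarrow> \<bar>lip_extension \<phi> F\<bar> \<le> e"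
proof -
  obtain \<eta> where \<eta>: "0 < \<eta>"
    "\<And>f. f \<in> little \<Longrightarrow> N f \<le> C \<Longrightarrow> (\<And>s. s \<in> mspace m \<Longrightarrow> \<bar>f s\<bar> \<le> \<eta>) \<Longrightarrow> \<bar>\<phi> f\<bar> \<le> e"
    using little_functional_small[OF \<phi> e] by blast
  have "\<bar>lip_extension \<phi> F\<bar> \<le> e"
    if F: "F \<in> big" "N F \<le> C" "\<And>s. s \<in> mspace m \<Longrightarrow> \<bar>F s\<bar> \<le> \<eta> / 2" for F
  proof (rule LIMSEQ_le_const2)
    show "(\<lambda>n. \<bar>\<phi> (approximant F n)\<bar>) \<longlonglongrightarrow> \<bar>lip_extension \<phi> F\<bar>"
      by (intro tendsto_rabs functional_tendsto_lip_extension[OF \<phi> F(1)] bounded_limit_approximant[OF F(1)])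
    obtain k where k: "inverse (real (Suc k)) < \<eta> / 2"
      using reals_Archimedean[of "\<eta> / 2"] \<eta>(1) by auto
    have "\<bar>\<phi> (approximant F n)\<bar> \<le> e" if n: "k \<le> n" for n
    proof (rule \<eta>(2)[OF approximant(1)[OF F(1)] order_trans[OF approximant(2)[OF F(1)] F(2)]])
      fix s assume s: "s \<in> mspace m"
      have "inverse (real (Suc n)) \<le> inverse (real (Suc k))" using n by simp
      then show "\<bar>approximant F n s\<bar> \<le> \<eta>"
        using approximant(3)[OF F(1) s, of n] F(3)[OF s] k by linarith
    qed
    then show "\<exists>k. \<forall>n\<ge>k. \<bar>\<phi> (approximant F n)\<bar> \<le> e" by blast
  qed
  with \<eta>(1) that[of "\<eta> / 2"] show thesis by simp
qed

end

context approximable_metric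
begin

section \<open>The M-ideal property\<close>

text \<open>
  Approximants \<open>f\<close> of \<open>G\<close> are taken at finer and finer scales, and \<open>g\<close> is the sum of \<open>k\<close> of them. Each
  difference \<open>G - f\<close> has norm at most 2, but for a given pair of points only one of the \<open>k\<close> differences
  can have a quotient that is close to 2: approximants of a coarser scale have negligible
  quotients there and leave that of \<open>G\<close>, while those of a finer scale cancel \<open>G\<close>.
  This is why the bound is about \<open>k\<close> and not \<open>2 * k\<close>.

  The induction keeps the bound \<open>k + 2\<close>. At distances below \<open>d\<close> the quotients of \<open>g\<close> are at most 1,
  and \<open>k * G\<close>, \<open>g\<close>, \<open>G\<close> and \<open>f\<close> together contribute at most \<open>k + 3\<close>. At larger distances the new
  difference \<open>G - f\<close> contributes at most 1, as it is at most \<open>d / 2\<close> everywhere.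
\<close>

lemma multiple_minus_little_norm:
  assumes G: "G \<in> big" "N G \<le> 1" and \<eta>: "0 < \<eta>"
  shows "\<exists>g\<in>little. (\<forall>s\<in>mspace m. \<bar>real k * G s - g s\<bar> \<le> real k * \<eta>) \<and>
    N (real k *\<^sub>R G - g) \<le> real k + 2"
proof (induction k)
  case 0
  have "N (real 0 *\<^sub>R G - 0) \<le> real 0 + 2"
    using nnorm_zero[OF normed_space_Lip0] by simp
  moreover have "\<forall>s\<in>mspace m. \<bar>real 0 * G s - 0 s\<bar> \<le> real 0 * \<eta>"
    by simp
  ultimately show ?case
    using subspace_0[OF subspace_little] by blast
next
  case (Suc k)
  then obtain g where g: "g \<in> little"
    "\<And>s. s \<in> mspace m \<Longrightarrow> \<bar>real k * G s - g s\<bar> \<le> real k * \<eta>"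
    "N (real k *\<^sub>R G - g) \<le> real k + 2" by blast
  obtain d where d: "0 < d"
    "\<And>s t. s \<in> mspace m \<Longrightarrow> t \<in> mspace m \<Longrightarrow> mdist m s t < d \<Longrightarrow> \<bar>g s - g t\<bar> \<le> 1 * mdist m s t"
    using littleD[OF g(1) zero_less_one] by blast
  have "0 < min \<eta> (d / 2)" using \<eta> d(1) by simp
  then obtain f where f: "f \<in> little" "N f \<le> N G"
    "\<And>s. s \<in> mspace m \<Longrightarrow> \<bar>G s - f s\<bar> \<le> min \<eta> (d / 2)"
    using approximable[OF G(1)] by blast
  have kG: "real k *\<^sub>R G - g \<in> big"
    using big_diff big_scale(1)[OF G(1)] little_imp_big[OF g(1)] by blast
  have one: "\<bar>h s - h t\<bar> \<le> mdist m s t"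
    if "h \<in> big" "N h \<le> 1" "s \<in> mspace m" "t \<in> mspace m" for h s t
    using lip_bound[OF that(1,3,4)] mult_right_mono[OF that(2) mdist_nonneg[of m s t]] by linarith
  have f1: "f \<in> big" "N f \<le> 1" using f(1,2) G(2) little_imp_big by auto
  have "N (real (Suc k) *\<^sub>R G - (g + f)) \<le> real (Suc k) + 2"
  proof (rule lip_norm_leI)
    fix s t assume st: "s \<in> mspace m" "t \<in> mspace m"
    let ?D = "mdist m s t"
    have split: "(real (Suc k) *\<^sub>R G - (g + f)) s - (real (Suc k) *\<^sub>R G - (g + f)) t
        = (real k * (G s - G t) - (g s - g t)) + ((G s - G t) - (f s - f t))"
      by (simp add: algebra_simps)
    have "\<bar>(real k * (G s - G t) - (g s - g t)) + ((G s - G t) - (f s - f t))\<bar> \<le> real k * ?D + 3 * ?D"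
    proof (cases "?D < d")
      case True
      have "\<bar>real k * (G s - G t)\<bar> \<le> real k * ?D"
        using one[OF G st] by (simp add: abs_mult mult_left_mono)
      with d(2)[OF st True] one[OF G st] one[OF f1 st] show ?thesis by linarith
    next
      case False
      have "\<bar>(real k *\<^sub>R G - g) s - (real k *\<^sub>R G - g) t\<bar> \<le> (real k + 2) * ?D"
        using lip_bound[OF kG st] mult_right_mono[OF g(3) mdist_nonneg[of m s t]] by linarith
      moreover have "(real k *\<^sub>R G - g) s - (real k *\<^sub>R G - g) t = real k * (G s - G t) - (g s - g t)"
        by (simp add: algebra_simps)
      ultimately have "\<bar>real k * (G s - G t) - (g s - g t)\<bar> \<le> real k * ?D + 2 * ?D"
        by (simp add: distrib_right)
      moreover have "\<bar>(G s - G t) - (f s - f t)\<bar> \<le> ?D"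
        using order_trans[OF f(3)[OF st(1)] min.cobounded2] order_trans[OF f(3)[OF st(2)] min.cobounded2]
          False by linarith
      ultimately show ?thesis by linarith
    qed
    then show "\<bar>(real (Suc k) *\<^sub>R G - (g + f)) s - (real (Suc k) *\<^sub>R G - (g + f)) t\<bar>
        \<le> (real (Suc k) + 2) * ?D"
      unfolding split by (simp add: algebra_simps)
  qed simp
  moreover have "\<bar>real (Suc k) * G s - (g + f) s\<bar> \<le> real (Suc k) * \<eta>" if s: "s \<in> mspace m" for s
  proof -
    have "\<bar>(real k * G s - g s) + (G s - f s)\<bar> \<le> real k * \<eta> + \<eta>"
      using g(2)[OF s] order_trans[OF f(3)[OF s] min.cobounded1] by linarith
    then show ?thesis by (simp add: algebra_simps)
  qed
  moreover have "g + f \<in> little" using g f subspace_add[OF subspace_little] by blast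
  ultimately show ?case by blast
qed

text \<open>
  Subtracting one approximant from \<open>G\<close> may double its norm; averaging \<open>k\<close> approximants of
  different scales reduces the bound to \<open>1 + 2 / k\<close>.
\<close>

lemma almost_norm_preserving_approximation:
  assumes G: "G \<in> big" "N G \<le> 1" and \<eta>: "0 < \<eta>"
  obtains g where "g \<in> little" "\<And>s. s \<in> mspace m \<Longrightarrow> \<bar>(G - g) s\<bar> \<le> \<eta>" "N (G - g) \<le> 1 + \<eta>"
proof -
  obtain k :: nat where k: "2 / \<eta> < real k" using reals_Archimedean2 by blast
  with \<eta> have pos: "0 < real k" using divide_pos_pos[of 2 \<eta>] by linarith
  obtain g where g: "g \<in> little"
    "\<And>s. s \<in> mspace m \<Longrightarrow> \<bar>real k * G s - g s\<bar> \<le> real k * \<eta>"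
    "N (real k *\<^sub>R G - g) \<le> real k + 2"
    using multiple_minus_little_norm[OF G \<eta>] by blast
  let ?g = "(1 / real k) *\<^sub>R g"
  have eq: "G - ?g = (1 / real k) *\<^sub>R (real k *\<^sub>R G - g)"
    using pos by (simp add: scaleR_diff_right)
  have kG: "real k *\<^sub>R G - g \<in> big"
    using big_diff big_scale(1)[OF G(1)] little_imp_big[OF g(1)] by blast
  show thesis
  proof (rule that)
    show "?g \<in> little" by (rule subspace_scale[OF subspace_little g(1)])
    show "\<bar>(G - ?g) s\<bar> \<le> \<eta>" if "s \<in> mspace m" for s
      unfolding eq using g(2)[OF that] pos by (simp add: pos_divide_le_eq mult.commute)
    have "N (G - ?g) \<le> \<bar>1 / real k\<bar> * N (real k *\<^sub>R G - g)"
      unfolding eq by (rule big_scale(2)[OF kG])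
    also have "\<dots> \<le> (1 / real k) * (real k + 2)"
      using pos g(3) by (simp add: divide_right_mono)
    also have "\<dots> = 1 + 2 / real k" using pos by (simp add: field_simps)
    also have "2 / real k \<le> \<eta>" using k pos \<eta> by (simp add: field_simps)
    finally show "N (G - ?g) \<le> 1 + \<eta>" by simp
  qed
qed

definition little_part :: "(('a \<Rightarrow> real) \<Rightarrow> real) \<Rightarrow> ('a \<Rightarrow> real) \<Rightarrow> real"
  where "little_part \<psi> = (\<lambda>f. if f \<in> little then \<psi> f else 0)"

lemma little_part_in_dual:
  assumes \<psi>: "\<psi> \<in> nvecs (dual (Lip0 m p))"
  shows "little_part \<psi> \<in> nvecs (dual (lip0 m p))"
proof (rule dualI)
  show "linear_map_on little (little_part \<psi>)"
    using dual_add[OF \<psi> little_imp_big little_imp_big] dual_scale[OF \<psi> little_imp_big]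
      subspace_add[OF subspace_little] subspace_scale[OF subspace_little]
    by (simp add: linear_map_on_def little_part_def)
  show "\<bar>little_part \<psi> f\<bar> \<le> nnorm (dual (Lip0 m p)) \<psi> * nnorm (lip0 m p) f" if "f \<in> little" for f
    using dual_norm_bound[OF normed_space_Lip0 \<psi> little_imp_big[OF that]] that
    by (simp add: little_part_def)
qed (simp add: little_part_def)

text \<open>
  Its kernel is the annihilator of lip0, since the extension of a functional on lip0 vanishes only if the
  functional does.
\<close>

definition M_projection :: "(('a \<Rightarrow> real) \<Rightarrow> real) \<Rightarrow> ('a \<Rightarrow> real) \<Rightarrow> real"
  where "M_projection \<psi> = lip_extension (little_part \<psi>)"

lemma M_projection_in_dual:
  "\<psi> \<in> nvecs (dual (Lip0 m p)) \<Longrightarrow> M_projection \<psi> \<in> nvecs (dual (Lip0 m p))"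
  unfolding M_projection_def by (intro lip_extension_in_dual little_part_in_dual)

lemma M_projection_little:
  "\<psi> \<in> nvecs (dual (Lip0 m p)) \<Longrightarrow> f \<in> little \<Longrightarrow> M_projection \<psi> f = \<psi> f"
  unfolding M_projection_def
  by (subst lip_extension_little[OF little_part_in_dual]) (simp_all add: little_part_def)

lemma M_projection_tendsto:
  assumes \<psi>: "\<psi> \<in> nvecs (dual (Lip0 m p))" and F: "F \<in> big"
  shows "(\<lambda>n. \<psi> (approximant F n)) \<longlonglongrightarrow> M_projection \<psi> F"
  using functional_tendsto_lip_extension[OF little_part_in_dual[OF \<psi>] F bounded_limit_approximant[OF F]]
  by (simp add: M_projection_def little_part_def approximant[OF F])

text \<open>
  Choose \<open>f\<close> and \<open>G\<close> in the unit ball that almost attain the norms of \<open>P \<psi>\<close> and \<open>\<psi> - P \<psi>\<close>. The first can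
  be taken in lip0, since \<open>P \<psi> F\<close> is a limit of values of \<open>\<psi>\<close> on approximants of \<open>F\<close>. The second
  can be replaced by \<open>G - g\<close> with \<open>g\<close> in lip0, because \<open>\<psi> - P \<psi>\<close> annihilates lip0. If \<open>G - g\<close> is
  uniformly small and has norm at most about 1, then \<open>f + (G - g)\<close> has norm at most about 1 as well, and
  \<open>\<psi>\<close> takes on it almost the sum of the two norms.
\<close>

lemma M_projection_norm:
  assumes \<psi>: "\<psi> \<in> nvecs (dual (Lip0 m p))"
  shows "nnorm (dual (Lip0 m p)) \<psi>
    = nnorm (dual (Lip0 m p)) (M_projection \<psi>) + nnorm (dual (Lip0 m p)) (\<psi> - M_projection \<psi>)"
proof (rule antisym)
  let ?P = "M_projection \<psi>" and ?N = "nnorm (dual (Lip0 m p))"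
  note E = normed_space_Lip0 and E' = normed_space_dual[OF normed_space_Lip0]
  note P = M_projection_in_dual[OF \<psi>]
  have Q: "\<psi> - ?P \<in> nvecs (dual (Lip0 m p))"
    using subspace_diff[OF normed_space_subspace[OF E'] \<psi> P] .
  show "?N \<psi> \<le> ?N ?P + ?N (\<psi> - ?P)"
    using nnorm_triangle[OF E' P Q] by simp
  show "?N ?P + ?N (\<psi> - ?P) \<le> ?N \<psi>"
  proof (rule field_le_epsilon)
    fix e :: real assume e: "0 < e"
    \<comment> \<open>Chosen to absorb the three errors \<open>r\<close> of values and the error \<open>2 * r\<close> of the norm.\<close>
    define K where "K = 3 + 2 * ?N \<psi>"
    have N\<psi>: "0 \<le> ?N \<psi>" by (rule nnorm_nonneg[OF E' \<psi>])
    then have K: "0 < K" by (simp add: K_def)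
    define r where "r = e / K"
    have r: "0 < r" using e K by (simp add: r_def)
    obtain F where F: "F \<in> big" "N F \<le> 1" "?N ?P - r < ?P F"
      using dual_norm_attained_approx[OF E P r] by auto
    have "\<exists>n. ?N ?P - r < \<psi> (approximant F n)"
      using order_tendstoD(1)[OF M_projection_tendsto[OF \<psi> F(1)] F(3)]
      by (auto simp: eventually_sequentially)
    then obtain f where f: "f \<in> little" "N f \<le> 1" "?N ?P - r < \<psi> f"
      using approximant[OF F(1)] F(2) by (meson order_trans)
    obtain G where G: "G \<in> big" "N G \<le> 1" "?N (\<psi> - ?P) - r < (\<psi> - ?P) G"
      using dual_norm_attained_approx[OF E Q r] by auto
    obtain \<eta>1 where \<eta>1: "0 < \<eta>1"
      "\<And>h. h \<in> big \<Longrightarrow> (\<And>s. s \<in> mspace m \<Longrightarrow> \<bar>h s\<bar> \<le> \<eta>1) \<Longrightarrow> N (f + h) \<le> max (N f) (N h) + r"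
      using norm_little_add_small[OF f(1) r] by blast
    obtain \<eta>2 where \<eta>2: "0 < \<eta>2"
      "\<And>h. h \<in> big \<Longrightarrow> N h \<le> 1 + r \<Longrightarrow> (\<And>s. s \<in> mspace m \<Longrightarrow> \<bar>h s\<bar> \<le> \<eta>2) \<Longrightarrow> \<bar>?P h\<bar> \<le> r"
      using lip_extension_small[OF little_part_in_dual[OF \<psi>] r] unfolding M_projection_def by blast
    define \<eta> where "\<eta> = min r (min \<eta>1 \<eta>2)"
    have \<eta>: "0 < \<eta>" "\<eta> \<le> r" "\<eta> \<le> \<eta>1" "\<eta> \<le> \<eta>2" using r \<eta>1(1) \<eta>2(1) by (auto simp: \<eta>_def)
    obtain g where g: "g \<in> little" "\<And>s. s \<in> mspace m \<Longrightarrow> \<bar>(G - g) s\<bar> \<le> \<eta>" "N (G - g) \<le> 1 + \<eta>"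
      using almost_norm_preserving_approximation[OF G(1,2) \<eta>(1)] by blast
    have h: "G - g \<in> big" using big_diff G(1) little_imp_big[OF g(1)] by blast
    have fh: "f + (G - g) \<in> big" using big_add(1)[OF little_imp_big[OF f(1)] h] .
    have "N (f + (G - g)) \<le> max (N f) (N (G - g)) + r"
      by (rule \<eta>1(2)[OF h order_trans[OF g(2) \<eta>(3)]])
    then have norm: "N (f + (G - g)) \<le> 1 + 2 * r"
      using f(2) g(3) \<eta>(2) r by linarith
    have small: "\<bar>?P (G - g)\<bar> \<le> r"
      using g(3) \<eta>(2) by (intro \<eta>2(2)[OF h _ order_trans[OF g(2) \<eta>(4)]]) linarith
    have "(\<psi> - ?P) (G - g) = (\<psi> - ?P) G - (\<psi> - ?P) g"
      by (rule dual_diff[OF E Q G(1) little_imp_big[OF g(1)]])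
    also have "(\<psi> - ?P) g = 0" by (simp add: M_projection_little[OF \<psi> g(1)])
    finally have "\<psi> (G - g) - ?P (G - g) = (\<psi> - ?P) G"
      unfolding minus_apply diff_zero .
    moreover have "\<psi> (f + (G - g)) = \<psi> f + \<psi> (G - g)"
      by (rule dual_add[OF \<psi> little_imp_big[OF f(1)] h])
    ultimately have "?N ?P + ?N (\<psi> - ?P) - 3 * r \<le> \<psi> (f + (G - g))"
      using f(3) G(3) small by linarith
    also have "\<dots> \<le> ?N \<psi> * N (f + (G - g))"
      using dual_norm_bound[OF E \<psi> fh] by simp
    also have "\<dots> \<le> ?N \<psi> * (1 + 2 * r)"
      using norm N\<psi> by (rule mult_left_mono)
    also have "\<dots> = ?N \<psi> + (K - 3) * r" by (simp add: K_def algebra_simps)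
    also have "\<dots> = ?N \<psi> + e - 3 * r" using K by (simp add: r_def algebra_simps)
    finally show "?N ?P + ?N (\<psi> - ?P) \<le> ?N \<psi> + e" by linarith
  qed
qed

lemma M_ideal_lip0: "M_ideal little (Lip0 m p)"
proof -
  let ?D = "nvecs (dual (Lip0 m p))"
  note P = M_projection_in_dual and lim = M_projection_tendsto
  have sub: "subspace ?D" using normed_space_subspace[OF normed_space_dual[OF normed_space_Lip0]] .
  have lin: "linear_map_on ?D M_projection"
    unfolding linear_map_on_def
  proof (intro conjI ballI allI)
    fix \<psi> c assume \<psi>: "\<psi> \<in> ?D"
    show "M_projection (\<psi> + \<theta>) = M_projection \<psi> + M_projection \<theta>" if \<theta>: "\<theta> \<in> ?D" for \<theta>
    proof (rule dual_eqI)
      show "M_projection (\<psi> + \<theta>) F = (M_projection \<psi> + M_projection \<theta>) F"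
        if "F \<in> nvecs (Lip0 m p)" for F
        using lim[OF subspace_add[OF sub \<psi> \<theta>] that] tendsto_add[OF lim[OF \<psi> that] lim[OF \<theta> that]]
        by (auto intro: LIMSEQ_unique)
    qed (intro P subspace_add[OF sub] \<psi> \<theta>)+
    show "M_projection (c *\<^sub>R \<psi>) = c *\<^sub>R M_projection \<psi>"
    proof (rule dual_eqI)
      show "M_projection (c *\<^sub>R \<psi>) F = (c *\<^sub>R M_projection \<psi>) F" if "F \<in> nvecs (Lip0 m p)" for F
        using lim[OF subspace_scale[OF sub \<psi>] that] tendsto_mult_left[OF lim[OF \<psi> that], of c]
        by (auto intro: LIMSEQ_unique)
    qed (intro P subspace_scale[OF sub] \<psi>)+
  qed
  have zero_part: "lip_extension (\<lambda>f. 0) = (\<lambda>F. 0)"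
    by (auto simp: lip_extension_def)
  have idem: "M_projection (M_projection \<psi>) = M_projection \<psi>" if "\<psi> \<in> ?D" for \<psi>
  proof -
    have "little_part (M_projection \<psi>) = little_part \<psi>"
      using M_projection_little[OF that] by (auto simp: little_part_def)
    then show ?thesis by (simp add: M_projection_def)
  qed
  have ker: "{\<psi> \<in> ?D. M_projection \<psi> = 0} = annihilator little (Lip0 m p)"
  proof (intro equalityI subsetI)
    fix \<psi> assume "\<psi> \<in> {\<psi> \<in> ?D. M_projection \<psi> = 0}"
    then have "\<psi> \<in> ?D" "\<And>f. f \<in> little \<Longrightarrow> \<psi> f = 0"
      using M_projection_little[of \<psi>] by auto
    then show "\<psi> \<in> annihilator little (Lip0 m p)" by (simp add: annihilator_def)
  next
    fix \<psi> assume "\<psi> \<in> annihilator little (Lip0 m p)"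
    then have \<psi>: "\<psi> \<in> ?D" "little_part \<psi> = (\<lambda>f. 0)"
      by (auto simp: annihilator_def little_part_def)
    then show "\<psi> \<in> {\<psi> \<in> ?D. M_projection \<psi> = 0}"
      by (simp add: M_projection_def zero_part zero_fun_def)
  qed
  show ?thesis
    unfolding M_ideal_def
    using banach_space_Lip0 closed_subspace_lip0 lin P idem ker M_projection_norm
    by (intro conjI exI[of _ M_projection]) blast+
qed

end

section \<open>The bidual of lip0\<close>

locale totally_bounded_approximable_metric = approximable_metric +
  assumes finite_net: "0 < \<eta> \<Longrightarrow>
    \<exists>A. finite A \<and> A \<subseteq> mspace m \<and> (\<forall>s\<in>mspace m. \<exists>t\<in>A. mdist m s t < \<eta>)"
begin

definition eval_at :: "'a \<Rightarrow> ('a \<Rightarrow> real) \<Rightarrow> real"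
  where "eval_at s = (\<lambda>f. if f \<in> little then f s else 0)"

lemma eval_at_diff_bound:
  assumes "s \<in> mspace m" "t \<in> mspace m" "f \<in> little"
  shows "\<bar>eval_at s f - eval_at t f\<bar> \<le> mdist m s t * N f"
  using lip_bound[OF little_imp_big[OF assms(3)] assms(1,2)] assms(3)
  by (simp add: eval_at_def mult.commute)

lemma eval_at_in_dual: "eval_at s \<in> nvecs (dual (lip0 m p))"
proof (rule dualI)
  show "linear_map_on little (eval_at s)"
    using subspace_add[OF subspace_little] subspace_scale[OF subspace_little]
    by (simp add: linear_map_on_def eval_at_def)
  show "\<bar>eval_at s f\<bar> \<le> mdist m s p * nnorm (lip0 m p) f" if f: "f \<in> little" for f
  proof (cases "s \<in> mspace m")
    case True
    with sup_bound[OF little_imp_big[OF f]] f show ?thesis by (simp add: eval_at_def mult.commute)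
  next
    case False
    with big_outside[OF little_imp_big[OF f]] lip_norm_nonneg[OF little_imp_big[OF f]]
    show ?thesis by (simp add: eval_at_def)
  qed
qed (simp add: eval_at_def)

text \<open>
  By the gliding hump, \<open>\<phi>\<close> is small on the functions of the unit ball that vanish on a sufficiently fine
  finite net, as these are uniformly small. A functional that is small on the joint kernel of
  finitely many evaluations is close to their span.
\<close>

lemma evaluations_dense:
  assumes \<phi>: "\<phi> \<in> nvecs (dual (lip0 m p))" and e: "0 < e"
  obtains A a where "finite A" "A \<subseteq> mspace m"
    "\<And>f. f \<in> little \<Longrightarrow> \<bar>\<phi> f - (\<Sum>s\<in>A. a s * f s)\<bar> \<le> e * N f"
proof -
  obtain \<eta> where \<eta>: "0 < \<eta>"
    "\<And>f. f \<in> little \<Longrightarrow> N f \<le> 1 \<Longrightarrow> (\<And>s. s \<in> mspace m \<Longrightarrow> \<bar>f s\<bar> \<le> \<eta>) \<Longrightarrow> \<bar>\<phi> f\<bar> \<le> e"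
    using little_functional_small[OF \<phi> e] by blast
  obtain A where A: "finite A" "A \<subseteq> mspace m" "\<And>s. s \<in> mspace m \<Longrightarrow> \<exists>t\<in>A. mdist m s t < \<eta>"
    using finite_net[OF \<eta>(1)] by blast
  have small: "\<bar>\<phi> f\<bar> \<le> e * nnorm (lip0 m p) f"
    if f: "f \<in> little" and zero: "\<And>t. t \<in> A \<Longrightarrow> f t = 0" for f
  proof (cases "N f = 0")
    case True
    then have "f = 0" using nnorm_eq_0_iff[OF normed_space_lip0 f] by simp
    then show ?thesis using dual_zero[OF normed_space_lip0 \<phi>] True by simp
  next
    case False
    then have pos: "0 < N f" using lip_norm_nonneg[OF little_imp_big[OF f]] by linarith
    let ?f = "(1 / N f) *\<^sub>R f"
    have f': "?f \<in> little" by (rule subspace_scale[OF subspace_little f])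
    have n: "N ?f \<le> 1" using nnorm_scale[OF normed_space_lip0 f, of "1 / N f"] pos by simp
    have "\<bar>?f s\<bar> \<le> \<eta>" if s: "s \<in> mspace m" for s
    proof -
      obtain t where t: "t \<in> A" "mdist m s t < \<eta>" using A(3)[OF s] by blast
      have "\<bar>?f s - ?f t\<bar> \<le> N ?f * mdist m s t"
        using lip_bound[OF little_imp_big[OF f'] s] t(1) A(2) by blast
      also have "\<dots> \<le> 1 * mdist m s t" using n by (rule mult_right_mono) simp
      finally show ?thesis using t(2) zero[OF t(1)] by simp
    qed
    then have "\<bar>\<phi> ?f\<bar> \<le> e" using \<eta>(2)[OF f' n] by blast
    then show ?thesis
      using dual_scale[OF \<phi>, of f "1 / N f"] f pos by (simp add: pos_divide_le_eq)
  qed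
  have lin: "linear_map_on little (\<lambda>f. f s)" for s
    by (simp add: linear_map_on_def)
  have "\<exists>a. \<forall>f\<in>little. \<bar>\<phi> f - (\<Sum>s\<in>A. a s * f s)\<bar> \<le> e * nnorm (lip0 m p) f"
    by (rule small_on_joint_kernel_imp_near_span[OF normed_space_lip0 _ A(1) subspace_little subset_refl])
      (use e small lin dual_linear[OF \<phi>] in auto)
  with A(1,2) that show thesis by (metis nnorm_lip0)
qed

definition bidual_map :: "((('a \<Rightarrow> real) \<Rightarrow> real) \<Rightarrow> real) \<Rightarrow> 'a \<Rightarrow> real"
  where "bidual_map \<Phi> = (\<lambda>s. \<Phi> (eval_at s))"

lemma bidual_map_in_big:
  assumes \<Phi>: "\<Phi> \<in> nvecs (dual (dual (lip0 m p)))"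
  shows "bidual_map \<Phi> \<in> big" "N (bidual_map \<Phi>) \<le> nnorm (dual (dual (lip0 m p))) \<Phi>"
proof -
  let ?C = "nnorm (dual (dual (lip0 m p))) \<Phi>"
  note E = normed_space_lip0 and E' = normed_space_dual[OF normed_space_lip0]
  have C: "0 \<le> ?C" by (rule nnorm_nonneg[OF normed_space_dual[OF E'] \<Phi>])
  have b: "\<bar>bidual_map \<Phi> s - bidual_map \<Phi> t\<bar> \<le> ?C * mdist m s t"
    if st: "s \<in> mspace m" "t \<in> mspace m" for s t
  proof -
    have d: "eval_at s - eval_at t \<in> nvecs (dual (lip0 m p))"
      by (intro subspace_diff[OF normed_space_subspace[OF E']] eval_at_in_dual)
    have "\<bar>\<Phi> (eval_at s - eval_at t)\<bar> \<le> ?C * nnorm (dual (lip0 m p)) (eval_at s - eval_at t)"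
      by (rule dual_norm_bound[OF E' \<Phi> d])
    also have "\<dots> \<le> ?C * mdist m s t"
      using eval_at_diff_bound[OF st] by (intro mult_left_mono[OF _ C] dual_norm_leI_bound[OF E]) simp_all
    finally show ?thesis
      by (simp add: bidual_map_def dual_diff[OF E' \<Phi> eval_at_in_dual eval_at_in_dual])
  qed
  have "eval_at s = 0" if "s \<notin> mspace m \<or> s = p" for s
    using that big_outside big_base_point little_imp_big by (auto simp: eval_at_def fun_eq_iff)
  then have z: "bidual_map \<Phi> s = 0" if "s \<notin> mspace m \<or> s = p" for s
    using that dual_zero[OF E' \<Phi>] by (simp add: bidual_map_def)
  show "bidual_map \<Phi> \<in> big" by (rule Lip0I[OF b]) (simp_all add: z)
  show "N (bidual_map \<Phi>) \<le> ?C" using C b by (rule lip_norm_leI)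
qed

text \<open>
  The converse norm estimate. Up to small errors, \<open>\<phi>\<close> is a combination \<open>\<mu>\<close> of finitely many evaluations, and on
  these finitely many points the function \<open>F\<close> that represents \<open>\<Phi>\<close> agrees with some \<open>f\<close> in lip0 of norm at most
  \<open>N F\<close>. Hence \<open>\<Phi> \<phi>\<close>, \<open>\<Phi> \<mu>\<close>, \<open>\<mu> f\<close> and \<open>\<phi> f\<close> are all close to each other.
\<close>

lemma bidual_bound:
  assumes \<Phi>: "\<Phi> \<in> nvecs (dual (dual (lip0 m p)))" and \<phi>: "\<phi> \<in> nvecs (dual (lip0 m p))"
  shows "\<bar>\<Phi> \<phi>\<bar> \<le> N (bidual_map \<Phi>) * nnorm (dual (lip0 m p)) \<phi>"
proof (rule field_le_epsilon)
  let ?F = "bidual_map \<Phi>" and ?N = "nnorm (dual (lip0 m p))" and ?C = "nnorm (dual (dual (lip0 m p))) \<Phi>"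
  note E = normed_space_lip0 and E' = normed_space_dual[OF normed_space_lip0]
  note F = bidual_map_in_big(1)[OF \<Phi>]
  fix e :: real assume e: "0 < e"
  have C: "0 \<le> ?C" by (rule nnorm_nonneg[OF normed_space_dual[OF E'] \<Phi>])
  \<comment> \<open>The three steps from \<open>\<Phi> \<phi>\<close> to \<open>\<phi> f\<close> cost \<open>?C * r\<close>, \<open>r\<close> and \<open>r * N F\<close>.\<close>
  define K where "K = ?C + 1 + N ?F"
  have K: "0 < K" using C lip_norm_nonneg[OF F] by (simp add: K_def)
  define r where "r = e / K"
  have r: "0 < r" using e K by (simp add: r_def)
  obtain A a where A: "finite A" "A \<subseteq> mspace m"
    and a: "\<And>f. f \<in> little \<Longrightarrow> \<bar>\<phi> f - (\<Sum>s\<in>A. a s * f s)\<bar> \<le> r * N f"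
    using evaluations_dense[OF \<phi> r] by blast
  define \<mu> where "\<mu> = (\<Sum>s\<in>A. a s *\<^sub>R eval_at s)"
  have \<mu>: "\<mu> \<in> nvecs (dual (lip0 m p))"
    unfolding \<mu>_def by (intro subspace_sum subspace_scale normed_space_subspace[OF E'] eval_at_in_dual)
  have \<mu>_apply: "\<mu> f = (\<Sum>s\<in>A. a s * f s)" if "f \<in> little" for f
  proof -
    have "(\<Sum>s\<in>B. a s *\<^sub>R eval_at s) f = (\<Sum>s\<in>B. a s * f s)" for B
      using that by (induction B rule: infinite_finite_induct) (simp_all add: eval_at_def)
    then show ?thesis by (simp add: \<mu>_def)
  qed
  have diff: "\<phi> - \<mu> \<in> nvecs (dual (lip0 m p))"
    by (rule subspace_diff[OF normed_space_subspace[OF E'] \<phi> \<mu>])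
  have "?N (\<phi> - \<mu>) \<le> r"
    using r a by (intro dual_norm_leI_bound[OF E]) (simp_all add: \<mu>_apply)
  then have "\<bar>\<Phi> (\<phi> - \<mu>)\<bar> \<le> ?C * r"
    using dual_norm_bound[OF E' \<Phi> diff] mult_left_mono[OF _ C] order_trans by blast
  then have 1: "\<bar>\<Phi> \<phi> - \<Phi> \<mu>\<bar> \<le> ?C * r" by (simp add: dual_diff[OF E' \<Phi> \<phi> \<mu>])
  have \<Phi>\<mu>: "\<Phi> \<mu> = (\<Sum>s\<in>A. a s * ?F s)"
    unfolding \<mu>_def
    using linear_map_on_sum[OF dual_linear[OF \<Phi>] normed_space_subspace[OF E'] eval_at_in_dual]
    by (simp add: bidual_map_def)
  define S where "S = 1 + (\<Sum>s\<in>A. \<bar>a s\<bar>)"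
  have S: "0 < S" unfolding S_def by (intro add_pos_nonneg sum_nonneg) simp_all
  obtain f where f: "f \<in> little" "N f \<le> N ?F" "\<And>s. s \<in> mspace m \<Longrightarrow> \<bar>?F s - f s\<bar> \<le> r / S"
    using approximable[OF F divide_pos_pos[OF r S]] by blast
  have "\<bar>\<Phi> \<mu> - \<mu> f\<bar> = \<bar>\<Sum>s\<in>A. a s * (?F s - f s)\<bar>"
    by (simp add: \<Phi>\<mu> \<mu>_apply[OF f(1)] right_diff_distrib sum_subtractf)
  also have "\<dots> \<le> (\<Sum>s\<in>A. \<bar>a s\<bar> * (r / S))"
  proof (rule order_trans[OF sum_abs sum_mono])
    show "\<bar>a s * (?F s - f s)\<bar> \<le> \<bar>a s\<bar> * (r / S)" if "s \<in> A" for s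
      unfolding abs_mult using that A(2) f(3) by (intro mult_left_mono) auto
  qed
  also have "\<dots> \<le> S * (r / S)"
    unfolding sum_distrib_right[symmetric] using r S by (intro mult_right_mono) (simp_all add: S_def)
  finally have 2: "\<bar>\<Phi> \<mu> - \<mu> f\<bar> \<le> r" using S by simp
  have "\<bar>\<phi> f - \<mu> f\<bar> \<le> r * N f" using a[OF f(1)] by (simp add: \<mu>_apply[OF f(1)])
  also have "\<dots> \<le> r * N ?F" using f(2) r by (intro mult_left_mono) simp_all
  finally have 3: "\<bar>\<phi> f - \<mu> f\<bar> \<le> r * N ?F" .
  have "\<bar>\<phi> f\<bar> \<le> ?N \<phi> * N f" using dual_norm_bound[OF E \<phi> f(1)] by simp
  also have "\<dots> \<le> ?N \<phi> * N ?F"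
    using f(2) nnorm_nonneg[OF E' \<phi>] by (rule mult_left_mono)
  finally have "\<bar>\<Phi> \<phi>\<bar> \<le> ?N \<phi> * N ?F + (?C * r + r + r * N ?F)"
    using 1 2 3 by linarith
  also have "?C * r + r + r * N ?F = K * r" by (simp add: K_def algebra_simps)
  also have "K * r = e" using K by (simp add: r_def)
  finally show "\<bar>\<Phi> \<phi>\<bar> \<le> N ?F * ?N \<phi> + e" by (simp add: mult.commute)
qed

definition bidual_inverse :: "('a \<Rightarrow> real) \<Rightarrow> (('a \<Rightarrow> real) \<Rightarrow> real) \<Rightarrow> real"
  where "bidual_inverse F = (\<lambda>\<phi>. if \<phi> \<in> nvecs (dual (lip0 m p)) then lip_extension \<phi> F else 0)"

lemma bidual_inverse_in_bidual:
  assumes F: "F \<in> big"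
  shows "bidual_inverse F \<in> nvecs (dual (dual (lip0 m p)))"
proof (rule dualI)
  note lim = functional_tendsto_lip_extension[OF _ F bounded_limit_approximant[OF F]]
  have sub: "subspace (nvecs (dual (lip0 m p)))"
    by (rule normed_space_subspace[OF normed_space_dual[OF normed_space_lip0]])
  show "linear_map_on (nvecs (dual (lip0 m p))) (bidual_inverse F)"
    unfolding linear_map_on_def
  proof (intro conjI ballI allI)
    fix \<phi> c assume \<phi>: "\<phi> \<in> nvecs (dual (lip0 m p))"
    show "bidual_inverse F (\<phi> + \<psi>) = bidual_inverse F \<phi> + bidual_inverse F \<psi>"
      if \<psi>: "\<psi> \<in> nvecs (dual (lip0 m p))" for \<psi>
      using lim[OF subspace_add[OF sub \<phi> \<psi>]] tendsto_add[OF lim[OF \<phi>] lim[OF \<psi>]]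
        subspace_add[OF sub \<phi> \<psi>] \<phi> \<psi>
      by (auto simp: bidual_inverse_def intro: LIMSEQ_unique)
    show "bidual_inverse F (c *\<^sub>R \<phi>) = c *\<^sub>R bidual_inverse F \<phi>"
      using lim[OF subspace_scale[OF sub \<phi>]] tendsto_mult_left[OF lim[OF \<phi>], of c]
        subspace_scale[OF sub \<phi>] \<phi>
      by (auto simp: bidual_inverse_def intro: LIMSEQ_unique)
  qed
  show "\<bar>bidual_inverse F \<phi>\<bar> \<le> N F * nnorm (dual (lip0 m p)) \<phi>"
    if "\<phi> \<in> nvecs (dual (lip0 m p))" for \<phi>
    using lip_extension_bound[OF that F] that by (simp add: bidual_inverse_def mult.commute)
qed (simp add: bidual_inverse_def)

lemma bidual_map_inverse:
  assumes F: "F \<in> big"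
  shows "bidual_map (bidual_inverse F) = F"
proof
  fix s
  have "lip_extension (eval_at s) F = F s"
  proof (cases "s \<in> mspace m")
    case True
    have "(\<lambda>n. approximant F n s - F s) \<longlonglongrightarrow> 0"
      by (rule tendsto_rabs_zero_cancel, rule tendsto_sandwich[OF _ _ tendsto_const LIMSEQ_inverse_real_of_nat])
        (use approximant(3)[OF F True] in \<open>auto simp: abs_minus_commute\<close>)
    then have "(\<lambda>n. approximant F n s) \<longlonglongrightarrow> F s" by (simp add: LIM_zero_iff)
    moreover have "(\<lambda>n. eval_at s (approximant F n)) \<longlonglongrightarrow> lip_extension (eval_at s) F"
      by (rule functional_tendsto_lip_extension[OF eval_at_in_dual F bounded_limit_approximant[OF F]])
    ultimately show ?thesis
      by (auto simp: eval_at_def approximant[OF F] intro: LIMSEQ_unique)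
  next
    case False
    have "(\<lambda>n. eval_at s (approximant F n)) \<longlonglongrightarrow> lip_extension (eval_at s) F"
      by (rule functional_tendsto_lip_extension[OF eval_at_in_dual F bounded_limit_approximant[OF F]])
    moreover have "eval_at s (approximant F n) = 0" for n
      using big_outside[OF little_imp_big False] by (simp add: eval_at_def)
    ultimately show ?thesis
      using big_outside[OF F False] by (simp add: LIMSEQ_const_iff)
  qed
  then show "bidual_map (bidual_inverse F) s = F s"
    by (simp add: bidual_map_def bidual_inverse_def eval_at_in_dual)
qed

lemma bidual_map_isometry:
  "surj_linear_isometry (dual (dual (lip0 m p))) (Lip0 m p) bidual_map"
  unfolding surj_linear_isometry_def
proof (intro conjI ballI)
  show "linear_map_on (nvecs (dual (dual (lip0 m p)))) bidual_map"
    by (simp add: linear_map_on_def bidual_map_def fun_eq_iff)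
  show "bidual_map ` nvecs (dual (dual (lip0 m p))) = big"
    using bidual_map_in_big(1) bidual_inverse_in_bidual bidual_map_inverse
    by (metis (no_types, lifting) image_eqI image_subsetI subsetI subset_antisym)
  fix \<Phi> assume \<Phi>: "\<Phi> \<in> nvecs (dual (dual (lip0 m p)))"
  show "nnorm (Lip0 m p) (bidual_map \<Phi>) = nnorm (dual (dual (lip0 m p))) \<Phi>"
  proof (rule antisym)
    show "nnorm (Lip0 m p) (bidual_map \<Phi>) \<le> nnorm (dual (dual (lip0 m p))) \<Phi>"
      using bidual_map_in_big(2)[OF \<Phi>] by simp
    show "nnorm (dual (dual (lip0 m p))) \<Phi> \<le> nnorm (Lip0 m p) (bidual_map \<Phi>)"
      using bidual_bound[OF \<Phi>] lip_norm_nonneg[OF bidual_map_in_big(1)[OF \<Phi>]]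
      by (intro dual_norm_leI_bound normed_space_dual normed_space_lip0) simp_all
  qed
qed

lemma bidual_map_canonical_embedding:
  assumes "f \<in> little"
  shows "bidual_map (canonical_embedding (lip0 m p) f) = f"
  using assms eval_at_in_dual by (simp add: bidual_map_def canonical_embedding_def eval_at_def fun_eq_iff)

end

section \<open>Snowflaked metrics\<close>

text \<open>
  The value at \<open>x\<close> is the minimum of \<open>x powr \<alpha>\<close> and the linear function through the origin that meets
  \<open>x powr \<alpha>\<close> at \<open>r\<close>. Written as \<open>x\<close> times a nonincreasing function, it is visibly subadditive.
\<close>

definition snowflake_gauge :: "real \<Rightarrow> real \<Rightarrow> real \<Rightarrow> real"
  where "snowflake_gauge \<alpha> r x = x * min (x powr (\<alpha> - 1)) (r powr (\<alpha> - 1))"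

lemma snowflake_gauge_bounds:
  assumes "0 \<le> x"
  shows "0 \<le> snowflake_gauge \<alpha> r x" "snowflake_gauge \<alpha> r x \<le> x powr \<alpha>"
    "snowflake_gauge \<alpha> r x \<le> r powr (\<alpha> - 1) * x"
proof -
  show "0 \<le> snowflake_gauge \<alpha> r x" using assms by (simp add: snowflake_gauge_def)
  have "snowflake_gauge \<alpha> r x \<le> x * x powr (\<alpha> - 1)"
    unfolding snowflake_gauge_def using assms by (intro mult_left_mono) simp_all
  then show "snowflake_gauge \<alpha> r x \<le> x powr \<alpha>"
    using powr_mult_base[OF assms, of "\<alpha> - 1"] by simp
  have "snowflake_gauge \<alpha> r x \<le> x * r powr (\<alpha> - 1)"
    unfolding snowflake_gauge_def using assms by (intro mult_left_mono) simp_all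
  then show "snowflake_gauge \<alpha> r x \<le> r powr (\<alpha> - 1) * x" by (simp add: mult.commute)
qed

lemma snowflake_gauge_zero [simp]: "snowflake_gauge \<alpha> r 0 = 0"
  by (simp add: snowflake_gauge_def)

lemma snowflake_gauge_gap:
  assumes "0 \<le> x" "0 < r" "0 < \<alpha>" "\<alpha> < 1"
  shows "x powr \<alpha> - snowflake_gauge \<alpha> r x \<le> r powr \<alpha>"
proof (cases "r \<le> x")
  case True
  then have "x powr (\<alpha> - 1) \<le> r powr (\<alpha> - 1)" using assms by (intro powr_mono2') simp_all
  then have "snowflake_gauge \<alpha> r x = x powr \<alpha>"
    using powr_mult_base[OF assms(1), of "\<alpha> - 1"] by (simp add: snowflake_gauge_def min_def)
  then show ?thesis by simp
next
  case False
  then have "x powr \<alpha> \<le> r powr \<alpha>" using assms by (intro powr_mono2) simp_all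
  with snowflake_gauge_bounds(1)[OF assms(1), of \<alpha> r] show ?thesis by linarith
qed

lemma snowflake_gauge_mono:
  assumes "0 \<le> x" "x \<le> y" "0 < r" "0 < \<alpha>"
  shows "snowflake_gauge \<alpha> r x \<le> snowflake_gauge \<alpha> r y"
proof -
  have eq: "snowflake_gauge \<alpha> r z = min (z powr \<alpha>) (z * r powr (\<alpha> - 1))" if "0 \<le> z" for z
    using powr_mult_base[OF that, of "\<alpha> - 1"] that
    by (simp add: snowflake_gauge_def min_mult_distrib_left)
  have "x powr \<alpha> \<le> y powr \<alpha>" using assms by (intro powr_mono2) simp_all
  moreover have "x * r powr (\<alpha> - 1) \<le> y * r powr (\<alpha> - 1)" using assms by (intro mult_right_mono) simp_all
  ultimately show ?thesis
    unfolding eq[OF assms(1)] eq[OF order_trans[OF assms(1,2)]] by (rule min.mono)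
qed

lemma snowflake_gauge_add:
  assumes "0 \<le> x" "0 \<le> y" "\<alpha> < 1"
  shows "snowflake_gauge \<alpha> r (x + y) \<le> snowflake_gauge \<alpha> r x + snowflake_gauge \<alpha> r y"
proof -
  let ?h = "\<lambda>z. min (z powr (\<alpha> - 1)) (r powr (\<alpha> - 1))"
  have step: "z * ?h (x + y) \<le> z * ?h z" if "0 \<le> z" "z \<le> x + y" for z
  proof (cases "z = 0")
    case False
    with that assms have "(x + y) powr (\<alpha> - 1) \<le> z powr (\<alpha> - 1)"
      by (intro powr_mono2') simp_all
    then have "?h (x + y) \<le> ?h z" by (intro min.mono) simp_all
    with that show ?thesis by (intro mult_left_mono)
  qed simp
  have "snowflake_gauge \<alpha> r (x + y) = x * ?h (x + y) + y * ?h (x + y)"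
    by (simp add: snowflake_gauge_def distrib_right)
  also have "\<dots> \<le> x * ?h x + y * ?h y" using assms by (intro add_mono step) simp_all
  finally show ?thesis by (simp add: snowflake_gauge_def)
qed

text \<open>
  A Lipschitz function for the original metric is little Lipschitz for the snowflaked one, since
  \<open>D = D powr (1 - \<alpha>) * D powr \<alpha>\<close> and the first factor tends to 0 with the distance \<open>D\<close>.
\<close>

lemma linear_modulus_in_lip0_snowflake:
  assumes \<alpha>: "0 < \<alpha>" "\<alpha> < 1" and f: "f \<in> nvecs (Lip0 (snowflake \<alpha> m) p)"
    and C: "\<And>s t. s \<in> mspace m \<Longrightarrow> t \<in> mspace m \<Longrightarrow> \<bar>f s - f t\<bar> \<le> C * mdist m s t"
  shows "f \<in> nvecs (lip0 (snowflake \<alpha> m) p)"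
proof -
  have "\<exists>d>0. \<forall>s\<in>mspace m. \<forall>t\<in>mspace m. 0 < mdist m s t powr \<alpha> \<and> mdist m s t powr \<alpha> < d \<longrightarrow>
      \<bar>f s - f t\<bar> \<le> e * mdist m s t powr \<alpha>" if e: "0 < e" for e
  proof -
    define q where "q = e / (\<bar>C\<bar> + 1)"
    have q: "0 < q" using e by (simp add: q_def)
    define r where "r = q powr (1 / (1 - \<alpha>))"
    have r: "0 < r" using q by (simp add: r_def)
    have "\<bar>f s - f t\<bar> \<le> e * mdist m s t powr \<alpha>"
      if st: "s \<in> mspace m" "t \<in> mspace m" and less: "mdist m s t powr \<alpha> < r powr \<alpha>" for s t
    proof -
      let ?D = "mdist m s t"
      have "?D < r"
      proof (rule ccontr)
        assume "\<not> ?D < r"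
        then have "r powr \<alpha> \<le> ?D powr \<alpha>" using r \<alpha> by (intro powr_mono2) simp_all
        with less show False by simp
      qed
      then have "?D powr (1 - \<alpha>) \<le> r powr (1 - \<alpha>)" using \<alpha> by (intro powr_mono2) simp_all
      also have "\<dots> = q" using q \<alpha> by (simp add: r_def powr_powr)
      finally have Dq: "?D powr (1 - \<alpha>) \<le> q" .
      have split: "?D = ?D powr (1 - \<alpha>) * ?D powr \<alpha>"
        by (cases "?D = 0") (simp_all add: powr_add[symmetric])
      have "\<bar>f s - f t\<bar> \<le> C * ?D" using C st by blast
      also have "\<dots> \<le> (\<bar>C\<bar> + 1) * ?D" by (intro mult_right_mono) simp_all
      also have "\<dots> = (\<bar>C\<bar> + 1) * ?D powr (1 - \<alpha>) * ?D powr \<alpha>"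
        by (subst split) simp
      also have "\<dots> \<le> (\<bar>C\<bar> + 1) * q * ?D powr \<alpha>"
        using Dq by (intro mult_right_mono mult_left_mono) simp_all
      also have "(\<bar>C\<bar> + 1) * q = e" using abs_ge_zero[of C] unfolding q_def by simp
      finally show ?thesis .
    qed
    moreover have "0 < r powr \<alpha>" using r by simp
    ultimately show ?thesis by blast
  qed
  with f \<alpha> show ?thesis by (simp add: lip0_def)
qed

text \<open>
  The approximant is the infimal convolution of \<open>F\<close> with \<open>w\<close>, the gauge of the original metric times
  the norm \<open>L\<close> of \<open>F\<close>. As the gauge is subadditive and increasing, \<open>w\<close> satisfies the triangle inequality and
  the convolution has modulus \<open>w\<close>. The inequality \<open>w \<le> L * mdist m s t powr \<alpha>\<close> bounds its norm by \<open>L\<close>,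
  the linear bound on \<open>w\<close> puts it into lip0, and the gap between \<open>w\<close> and the first bound, which is
  at most \<open>L * r powr \<alpha>\<close>, also bounds the distance of the convolution to \<open>F\<close>.
\<close>

lemma snowflake_approximable:
  assumes p: "p \<in> mspace m" and \<alpha>: "0 < \<alpha>" "\<alpha> < 1"
    and F: "F \<in> nvecs (Lip0 (snowflake \<alpha> m) p)" and \<eta>: "0 < \<eta>"
  shows "\<exists>f\<in>nvecs (lip0 (snowflake \<alpha> m) p). lip_norm (snowflake \<alpha> m) f \<le> lip_norm (snowflake \<alpha> m) F \<and>
    (\<forall>s\<in>mspace m. \<bar>F s - f s\<bar> \<le> \<eta>)"
proof -
  interpret S: pointed_metric "snowflake \<alpha> m" p
    using p \<alpha> by unfold_locales simp
  define L where "L = lip_norm (snowflake \<alpha> m) F"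
  have L: "0 \<le> L" unfolding L_def by (rule S.lip_norm_nonneg[OF F])
  have F_bound: "\<bar>F s - F t\<bar> \<le> L * mdist m s t powr \<alpha>" if "s \<in> mspace m" "t \<in> mspace m" for s t
    using S.lip_bound[OF F] that \<alpha> by (simp add: L_def)
  \<comment> \<open>Half of \<open>\<eta>\<close> is kept for the constant \<open>g p\<close> that is subtracted below to vanish at \<open>p\<close>.\<close>
  define q where "q = \<eta> / (2 * (L + 1))"
  have q: "0 < q" using L \<eta> by (simp add: q_def)
  define r where "r = q powr (1 / \<alpha>)"
  have r: "0 < r" "r powr \<alpha> = q" using q \<alpha> by (simp_all add: r_def powr_powr)
  have Lq: "L * q \<le> \<eta> / 2"
  proof -
    have "L * q \<le> (L + 1) * q" using q by (intro mult_right_mono) simp_all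
    also have "\<dots> = \<eta> / 2" using L by (simp add: q_def field_simps)
    finally show ?thesis .
  qed
  define w where "w s t = L * snowflake_gauge \<alpha> r (mdist m s t)" for s t
  have w_self: "w s s = 0" if "s \<in> mspace m" for s
    using that by (simp add: w_def)
  have w_commute: "w s t = w t s" for s t
    by (simp add: w_def mdist_commute)
  have w_le: "w s t \<le> L * mdist m s t powr \<alpha>" "w s t \<le> (L * r powr (\<alpha> - 1)) * mdist m s t" for s t
    unfolding w_def mult.assoc by (intro mult_left_mono L snowflake_gauge_bounds mdist_nonneg)+
  have w_gap: "L * mdist m s t powr \<alpha> - w s t \<le> L * q" for s t
    using mult_left_mono[OF snowflake_gauge_gap[OF mdist_nonneg r(1) \<alpha>, of m s t] L]
    by (simp add: w_def r(2) right_diff_distrib)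
  have w_triangle: "w s u \<le> w s t + w t u" if "s \<in> mspace m" "t \<in> mspace m" "u \<in> mspace m" for s t u
  proof -
    have "snowflake_gauge \<alpha> r (mdist m s u) \<le> snowflake_gauge \<alpha> r (mdist m s t + mdist m t u)"
      using r \<alpha> that by (intro snowflake_gauge_mono mdist_triangle) simp_all
    also have "\<dots> \<le> snowflake_gauge \<alpha> r (mdist m s t) + snowflake_gauge \<alpha> r (mdist m t u)"
      using \<alpha> by (intro snowflake_gauge_add) simp_all
    finally show ?thesis
      unfolding w_def distrib_left[symmetric] using L by (rule mult_left_mono)
  qed
  define g where "g s = (INF t\<in>mspace m. F t + w s t)" for s
  have lower: "F s - L * q \<le> F t + w s t" if "s \<in> mspace m" "t \<in> mspace m" for s t
    using F_bound[OF that] w_gap[of s t] by linarith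
  have g_le: "g s \<le> F t + w s t" if "s \<in> mspace m" "t \<in> mspace m" for s t
    unfolding g_def using that lower[OF that(1)] by (intro cINF_lower bdd_belowI2) auto
  have g_lower: "F s - L * q \<le> g s" if "s \<in> mspace m" for s
    unfolding g_def using p lower[OF that] by (intro cINF_greatest) auto
  have g_upper: "g s \<le> F s" if "s \<in> mspace m" for s
    using g_le[OF that that] w_self[OF that] by simp
  have g_one: "g s - w s s' \<le> g s'" if s: "s \<in> mspace m" "s' \<in> mspace m" for s s'
    unfolding g_def[of s']
  proof (rule cINF_greatest)
    show "g s - w s s' \<le> F t + w s' t" if "t \<in> mspace m" for t
      using g_le[OF s(1) that] w_triangle[OF s that] by linarith
  qed (use p in blast)
  define f where "f s = (if s \<in> mspace m then g s - g p else 0)" for s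
  have f_w: "\<bar>f s - f t\<bar> \<le> w s t" if "s \<in> mspace m" "t \<in> mspace m" for s t
    using g_one[OF that] g_one[OF that(2,1)] w_commute[of s t] that by (simp add: f_def)
  have f_bound: "\<bar>f s - f t\<bar> \<le> L * mdist (snowflake \<alpha> m) s t"
    if "s \<in> mspace (snowflake \<alpha> m)" "t \<in> mspace (snowflake \<alpha> m)" for s t
    using f_w[of s t] w_le(1)[of s t] that \<alpha> by simp
  have f_Lip0: "f \<in> nvecs (Lip0 (snowflake \<alpha> m) p)"
    by (rule Lip0I[OF f_bound]) (use \<alpha> p in \<open>simp_all add: f_def\<close>)
  have "f \<in> nvecs (lip0 (snowflake \<alpha> m) p)"
    using order_trans[OF f_w w_le(2)] by (rule linear_modulus_in_lip0_snowflake[OF \<alpha> f_Lip0])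
  moreover have "lip_norm (snowflake \<alpha> m) f \<le> lip_norm (snowflake \<alpha> m) F"
    using L f_bound unfolding L_def by (rule lip_norm_leI)
  moreover have "\<bar>F s - f s\<bar> \<le> \<eta>" if s: "s \<in> mspace m" for s
    using g_lower[OF s] g_upper[OF s] g_lower[OF p] g_upper[OF p] Lq S.big_base_point[OF F] s
    by (simp add: f_def)
  ultimately show ?thesis by blast
qed

lemma snowflake_finite_net:
  assumes m: "compact_space (mtopology_of m)" and \<alpha>: "0 < \<alpha>" "\<alpha> < 1" and \<eta>: "0 < \<eta>"
  shows "\<exists>A. finite A \<and> A \<subseteq> mspace m \<and> (\<forall>s\<in>mspace m. \<exists>t\<in>A. mdist m s t powr \<alpha> < \<eta>)"
proof -
  interpret M: Metric_space "mspace m" "mdist m" by (rule Metric_space_mspace_mdist)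
  have bounded: "M.mtotally_bounded (mspace m)"
    using m by (intro M.compactin_imp_mtotally_bounded) (simp add: compact_space_def mtopology_of_def)
  have r: "0 < \<eta> powr (1 / \<alpha>)" using \<eta> by simp
  obtain A where A: "finite A" "A \<subseteq> mspace m"
    "mspace m \<subseteq> (\<Union>x\<in>A. M.mball x (\<eta> powr (1 / \<alpha>)))"
    using bounded[unfolded M.mtotally_bounded_def, rule_format, OF r] by blast
  have "\<exists>t\<in>A. mdist m s t powr \<alpha> < \<eta>" if s: "s \<in> mspace m" for s
  proof -
    obtain t where t: "t \<in> A" "mdist m s t < \<eta> powr (1 / \<alpha>)"
      using A(3) s by (auto simp: mdist_commute)
    have "mdist m s t powr \<alpha> < (\<eta> powr (1 / \<alpha>)) powr \<alpha>"
      using t(2) \<alpha> by (intro powr_less_mono2) simp_all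
    also have "\<dots> = \<eta>" using \<eta> \<alpha> by (simp add: powr_powr)
    finally show ?thesis using t(1) by blast
  qed
  with A(1,2) show ?thesis by blast
qed

section \<open>The bidual of lip0 over a snowflaked compact space\<close>

theorem corollary4p4:
  fixes m :: "'a metric" and p :: 'a and \<alpha> :: real
  assumes "compact_space (mtopology_of m)"
    and "p \<in> mspace m"
    and "0 < \<alpha>" and "\<alpha> < 1"
  shows "(\<exists>I. surj_linear_isometry (dual (dual (lip0 (snowflake \<alpha> m) p))) (Lip0 (snowflake \<alpha> m) p) I \<and>
              (\<forall>f \<in> nvecs (lip0 (snowflake \<alpha> m) p).
                 I (canonical_embedding (lip0 (snowflake \<alpha> m) p) f) = f)) \<and>
         M_ideal (nvecs (lip0 (snowflake \<alpha> m) p)) (Lip0 (snowflake \<alpha> m) p)"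
proof -
  interpret totally_bounded_approximable_metric "snowflake \<alpha> m" p
  proof
    show "p \<in> mspace (snowflake \<alpha> m)" using assms by simp
  next
    fix F and \<eta> :: real assume "F \<in> nvecs (Lip0 (snowflake \<alpha> m) p)" "0 < \<eta>"
    then show "\<exists>f\<in>nvecs (lip0 (snowflake \<alpha> m) p).
        lip_norm (snowflake \<alpha> m) f \<le> lip_norm (snowflake \<alpha> m) F \<and>
        (\<forall>s\<in>mspace (snowflake \<alpha> m). \<bar>F s - f s\<bar> \<le> \<eta>)"
      using snowflake_approximable[OF assms(2-4)] assms(3,4) by simp
  next
    fix \<eta> :: real assume "0 < \<eta>"
    then show "\<exists>A. finite A \<and> A \<subseteq> mspace (snowflake \<alpha> m) \<and>
        (\<forall>s\<in>mspace (snowflake \<alpha> m). \<exists>t\<in>A. mdist (snowflake \<alpha> m) s t < \<eta>)"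
      using snowflake_finite_net[OF assms(1,3,4)] assms(3,4) by simp
  qed
  show ?thesis
    using bidual_map_isometry bidual_map_canonical_embedding M_ideal_lip0 by blast
qed

end
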